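(* Let $\alpha\in(0,2]$ and let $S=S^{\mathrm{ker}}_{\alpha}$ be the kernel score on $\mathbb{R}$, $$S^{\mathrm{ker}}_{\alpha}(\mathbb{P},y) = \frac12\mathsf{E}_{\mathbb{P},\mathbb{P}}[|X-Y|^{\alpha}] - \mathsf{E}_{\mathbb{P}}[|X-y|^{\alpha}].$$ Let $\mathcal{Q}$ be a class of probability measures $\mathbb{Q}_\theta$, $\theta=(\mu,\sigma)\in\mathbb{R}\times(0,\infty)$, which are location-scale transformations of base measures $\mathbb{Q}$ satisfying Assumption A (stated in the context) for this $\alpha$. Then the scale function of $S^{\mathrm{ker}}_{\alpha}$ on $\mathcal{Q}$ is $$s(\mathbb{Q}_\theta) = \sigma^{\alpha-2}s(\mathbb{Q}) = \sigma^{\alpha-2}\,\mathsf{E}_{\mathbb{Q},\mathbb{Q}}[H^{\alpha}_{\mathbb{Q}}(X,Y)],$$ where $H^{\alpha}_{\mathbb{Q}}(X,Y)$ is a $2\times2$ matrix (a function of $X,Y$, depending on $\mathbb{Q}$ and $\alpha$) independent of $\theta$.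
   Context: $\mathsf{E}_{\mathbb{P}}$ is expectation for $X\sim\mathbb{P}$; $\mathsf{E}_{\mathbb{P},\mathbb{Q}}$ is expectation for independent $X\sim\mathbb{P}$, $Y\sim\mathbb{Q}$. For a scoring rule $S$, $S(\mathbb{P},\mathbb{Q})$ is the expected value of $S(\mathbb{P},Y)$ when $Y\sim\mathbb{Q}$. Location-scale transformations: for a probability measure $\mathbb{Q}$ on $\mathbb{R}$ and $\theta=(\mu,\sigma)\in\mathbb{R}\times(0,\infty)$, $\mathbb{Q}_\theta$ is the law of $\mu+\sigma Z$ with $Z\sim\mathbb{Q}$; $\mathbb{Q}=\mathbb{Q}_{(0,1)}$. For a set $\mathcal{Q}_0$ of base measures, $\mathcal{Q}=\{\mathbb{Q}_\theta:\mathbb{Q}\in\mathcal{Q}_0,\theta\in\mathbb{R}\times(0,\infty)\}$, and it is assumed that $|S(\mathbb{P},\mathbb{P}')|<\infty$ for all $\mathbb{P},\mathbb{P}'\in\mathcal{Q}$. Scale function: $S$ has scale function $s$ on $\mathcal{Q}$ if, for every $\mathbb{Q}_\theta\in\mathcal{Q}$, $s(\mathbb{Q}_\theta)$ is the symmetric $2\times 2$ matrix with $S(\mathbb{Q}_\theta,\mathbb{Q}_\theta)-S(\mathbb{Q}_{\theta+d\theta},\mathbb{Q}_\theta)=d\theta^T s(\mathbb{Q}_\theta)\,d\theta+o(\|d\theta\|^2)$ as $d\theta\to0$. Assumption A (with parameter $\alpha\ge0$): the probability measure $\mathbb{Q}$ on $(\mathbb{R},\mathcal{B}(\mathbb{R}))$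 has density $\exp(\Psi)$ with respect to Lebesgue measure for some twice differentiable function $\Psi$ such that $\mathsf{E}_{\mathbb{Q}}[\Psi'(X)]$, $\mathsf{E}_{\mathbb{Q}}[\Psi''(X)]$, $\mathsf{E}_{\mathbb{Q}}[(\Psi'(X))^2]$ are finite, and $\mathsf{E}_{\mathbb{Q}}[|X|^{\alpha}]$, $\mathsf{E}_{\mathbb{Q}}[|X|^{\alpha+1}\Psi'(X)]$, $\mathsf{E}_{\mathbb{Q}}[|X|^{\alpha+3}\Psi''(X)]$, $\mathsf{E}_{\mathbb{Q}}[|X|^{\alpha+3}(\Psi'(X))^2]$ are finite. *)

theory Defs
  imports "HOL-Probability.Probability" "HOL-Library.Landau_Symbols"
begin

text \<open>A parameter \<open>\<theta> = (\<mu>, \<sigma>)\<close> is a vector in \<^typ>\<open>real ^ 2\<close>: \<open>\<theta> $ 1\<close> is the location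
  and \<open>\<theta> $ 2\<close> the scale.\<close>

definition location_scale :: "real ^ 2 \<Rightarrow> real measure \<Rightarrow> real measure" where
  "location_scale \<theta> Q = distr Q borel (\<lambda>z. \<theta> $ 1 + \<theta> $ 2 * z)"

definition location_scale_class :: "real measure set \<Rightarrow> real measure set" where
  "location_scale_class Q0 = {location_scale \<theta> Q | \<theta> Q. Q \<in> Q0 \<and> 0 < \<theta> $ 2}"

type_synonym scoring_rule = "real measure \<Rightarrow> real \<Rightarrow> real"

definition expected_score :: "scoring_rule \<Rightarrow> real measure \<Rightarrow> real measure \<Rightarrow> real" where
  "expected_score S P P' = (\<integral>y. S P y \<partial>P')"

definition finite_expected_scores :: "scoring_rule \<Rightarrow> real measure set \<Rightarrow> bool" where
  "finite_expected_scores S \<Q> \<longleftrightarrow> (\<forall>P\<in>\<Q>. \<forall>P'\<in>\<Q>. integrable P' (S P))"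

definition kernel_score :: "real \<Rightarrow> scoring_rule" where
  "kernel_score \<alpha> P y =
     1 / 2 * (\<integral>(x, x'). \<bar>x - x'\<bar> powr \<alpha> \<partial>(P \<Otimes>\<^sub>M P)) - (\<integral>x. \<bar>x - y\<bar> powr \<alpha> \<partial>P)"

text \<open>The scale function is indexed by the base measure and the parameter rather than by the
  transformed measure alone: if the base set contains two location-scale transforms of each
  other, one measure has several representations, and the matrix depends on the
  representation through the meaning of \<open>d\<theta>\<close>.\<close>

definition is_scale_function ::
  "scoring_rule \<Rightarrow> real measure set \<Rightarrow> (real measure \<Rightarrow> real ^ 2 \<Rightarrow> real ^ 2 ^ 2) \<Rightarrow> bool" where
  "is_scale_function S Q0 s \<longleftrightarrow>
     (\<forall>Q\<in>Q0. \<forall>\<theta>. 0 < \<theta> $ 2 \<longrightarrow>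
        transpose (s Q \<theta>) = s Q \<theta> \<and>
        (\<lambda>d. expected_score S (location_scale \<theta> Q) (location_scale \<theta> Q)
             - expected_score S (location_scale (\<theta> + d) Q) (location_scale \<theta> Q)
             - d \<bullet> (s Q \<theta> *v d)) \<in> o[at 0](\<lambda>d. (norm d)\<^sup>2))"

definition assumption_A :: "real \<Rightarrow> real measure \<Rightarrow> bool" where
  "assumption_A \<alpha> Q \<longleftrightarrow>
     prob_space Q \<and>
     (\<exists>\<Psi> \<Psi>' \<Psi>'' :: real \<Rightarrow> real.
        (\<forall>x. (\<Psi> has_real_derivative \<Psi>' x) (at x)) \<and>
        (\<forall>x. (\<Psi>' has_real_derivative \<Psi>'' x) (at x)) \<and>
        Q = density lborel (\<lambda>x. ennreal (exp (\<Psi> x))) \<and>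
        integrable Q \<Psi>' \<and>
        integrable Q \<Psi>'' \<and>
        integrable Q (\<lambda>x. (\<Psi>' x)\<^sup>2) \<and>
        integrable Q (\<lambda>x. \<bar>x\<bar> powr \<alpha>) \<and>
        integrable Q (\<lambda>x. \<bar>x\<bar> powr (\<alpha> + 1) * \<Psi>' x) \<and>
        integrable Q (\<lambda>x. \<bar>x\<bar> powr (\<alpha> + 3) * \<Psi>'' x) \<and>
        integrable Q (\<lambda>x. \<bar>x\<bar> powr (\<alpha> + 3) * (\<Psi>' x)\<^sup>2))"

end

theory Submission
  imports Defs
begin

text \<open>The kernel score sees a measure only through integrals of \<open>\<bar>x - y\<bar> powr \<alpha>\<close>. If \<open>p\<close> and \<open>p'\<close> are
  probability densities and \<open>B f g = \<integral>\<integral> \<bar>x - y\<bar> powr \<alpha> * f x * g y\<close>, then the expected score is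
  \<open>B p p / 2 - B p p'\<close>, so the divergence whose second order behaviour defines the scale function
  collapses to \<open>- B r r / 2\<close> with \<open>r = p' - p\<close>, the energy distance of the two densities.
  This is a quadratic expression in \<open>r\<close>. Hence a second order expansion of the divergence needs only
  a first order expansion of the density in the parameter, and the singularity of the kernel on the
  diagonal never has to be differentiated, however small \<open>\<alpha>\<close> is.

  The form \<open>B\<close> (\<open>kernel_form\<close>) is bounded on the \<open>L\<^sup>1\<close> space with weight \<open>1 + \<bar>x\<bar> powr \<alpha>\<close>
  (\<open>kernel_form_bound\<close>). In this space the density of the law of \<open>m + (1 + t) Z\<close> has the derivative
  \<open>- (m g1 + t g2)\<close> at \<open>m = t = 0\<close>, where \<open>g1 = q' = \<Psi>' q\<close> and
  \<open>g2 = q + x q' = (1 + x \<Psi>') q\<close> for the base density \<open>q = exp \<Psi>\<close>. By the fundamental theorem of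
  calculus and Fubini the remainder is controlled by the continuity of dilations and translations
  in the weighted space (\<open>wnorm_push_remainder_le\<close>), and that continuity follows from the lemma of Scheffe
  since \<open>\<Psi>'\<close> is continuous (\<open>tendsto_scaled_push\<close>). Inserting the expansion into \<open>B\<close> gives the
  quadratic form with entries \<open>- B gi gj / 2\<close> (\<open>kernel_form_tangent\<close>). In terms of \<open>Q\<close> these
  are the expectations of \<open>- \<bar>X - Y\<bar> powr \<alpha> * ui X * uj Y / 2\<close> with
  \<open>u = (\<Psi>' x, 1 + x \<Psi>' x)\<close>, which is the matrix \<open>H\<close> of the theorem.

  For a general parameter, moving \<open>(\<mu>, \<sigma>)\<close> by \<open>d\<close> is the transformation by \<open>(\<mu>, \<sigma>)\<close> applied to the
  move of the base measure by \<open>d / \<sigma>\<close>. The kernel is homogeneous of degree \<open>\<alpha>\<close>, so the divergence is multiplied by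
  \<open>\<sigma> powr \<alpha>\<close> (\<open>kernel_divergence_eq\<close>); the quadratic form in \<open>d / \<sigma>\<close> contributes the remaining
  factor \<open>\<sigma> powr (- 2)\<close>. Finally a symmetric matrix is determined by its quadratic form up to
  \<open>o((norm d)\<^sup>2)\<close> (\<open>symmetric_form_unique\<close>), so every scale function has these values.\<close>

section \<open>Weighted integrability and the energy form\<close>

definition weight :: "real \<Rightarrow> real \<Rightarrow> real" where
  "weight \<alpha> x = 1 + \<bar>x\<bar> powr \<alpha>"

lemma weight_measurable [measurable]: "weight \<alpha> \<in> borel_measurable borel"
  unfolding weight_def by measurable

lemma weight_ge_1: "1 \<le> weight \<alpha> x"
  by (simp add: weight_def)

lemma weight_pos: "0 < weight \<alpha> x"
  using weight_ge_1[of \<alpha> x] by linarith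

text \<open>A substitute for the convexity inequality that also covers exponents below one.\<close>

lemma abs_add_powr_le:
  fixes x y \<alpha> :: real
  assumes "0 \<le> \<alpha>"
  shows "\<bar>x + y\<bar> powr \<alpha> \<le> 2 powr \<alpha> * (\<bar>x\<bar> powr \<alpha> + \<bar>y\<bar> powr \<alpha>)"
proof -
  have "\<bar>x + y\<bar> powr \<alpha> \<le> (2 * max \<bar>x\<bar> \<bar>y\<bar>) powr \<alpha>"
    using assms by (intro powr_mono2) auto
  also have "\<dots> = 2 powr \<alpha> * max \<bar>x\<bar> \<bar>y\<bar> powr \<alpha>"
    by (simp add: powr_mult)
  also have "max \<bar>x\<bar> \<bar>y\<bar> powr \<alpha> \<le> \<bar>x\<bar> powr \<alpha> + \<bar>y\<bar> powr \<alpha>"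
    by (simp add: max_def)
  finally show ?thesis by simp
qed

text \<open>The product form of the bound separates the variables, so that a double integral against the
  kernel is dominated by a product of two weighted integrals.\<close>

lemma kernel_le_weight:
  assumes "0 \<le> \<alpha>"
  shows "\<bar>x - y\<bar> powr \<alpha> \<le> 2 powr \<alpha> * (weight \<alpha> x * weight \<alpha> y)"
proof -
  have "\<bar>x - y\<bar> powr \<alpha> \<le> 2 powr \<alpha> * (\<bar>x\<bar> powr \<alpha> + \<bar>y\<bar> powr \<alpha>)"
    using abs_add_powr_le[OF assms, of x "- y"] by simp
  also have "\<dots> \<le> 2 powr \<alpha> * (weight \<alpha> x * weight \<alpha> y)"
    by (intro mult_left_mono) (auto simp: weight_def algebra_simps)
  finally show ?thesis .
qed

text \<open>The constant depends only on bounds for the shift and the scale. Such uniformity provides the dominating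
  function when shift and scale vary.\<close>

lemma weight_affine_le:
  assumes "0 \<le> \<alpha>" "\<bar>m\<bar> \<le> a" "\<bar>s\<bar> \<le> b"
  shows "weight \<alpha> (m + s * z) \<le> (1 + 2 powr \<alpha> * (a powr \<alpha> + b powr \<alpha>)) * weight \<alpha> z"
proof -
  have "\<bar>m + s * z\<bar> powr \<alpha> \<le> 2 powr \<alpha> * (\<bar>m\<bar> powr \<alpha> + \<bar>s * z\<bar> powr \<alpha>)"
    by (rule abs_add_powr_le) fact
  also have "\<dots> \<le> 2 powr \<alpha> * (a powr \<alpha> + b powr \<alpha> * \<bar>z\<bar> powr \<alpha>)"
    using assms by (intro mult_left_mono add_mono powr_mono2)
      (auto simp: abs_mult powr_mult intro!: mult_right_mono powr_mono2)
  also have "\<dots> \<le> 2 powr \<alpha> * (a powr \<alpha> + b powr \<alpha>) * weight \<alpha> z"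
  proof -
    have "0 \<le> 2 powr \<alpha> * (a powr \<alpha> * \<bar>z\<bar> powr \<alpha> + b powr \<alpha>)" by simp
    then show ?thesis by (simp add: weight_def algebra_simps)
  qed
  finally show ?thesis
    using powr_ge_zero[of "\<bar>z\<bar>" \<alpha>] unfolding weight_def distrib_right mult_1_left by linarith
qed

text \<open>Integrability of the weighted function entails measurability of \<open>f\<close>, because the weight is
  positive and measurable.\<close>

definition wL1 :: "real \<Rightarrow> (real \<Rightarrow> real) \<Rightarrow> bool" where
  "wL1 \<alpha> f \<longleftrightarrow> integrable lborel (\<lambda>x. weight \<alpha> x * f x)"

definition wnorm :: "real \<Rightarrow> (real \<Rightarrow> real) \<Rightarrow> real" where
  "wnorm \<alpha> f = (\<integral>x. weight \<alpha> x * \<bar>f x\<bar> \<partial>lborel)"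

lemma wL1_measurable: "wL1 \<alpha> f \<Longrightarrow> f \<in> borel_measurable borel"
proof -
  assume "wL1 \<alpha> f"
  then have "(\<lambda>x. weight \<alpha> x * f x) \<in> borel_measurable borel"
    by (auto simp: wL1_def dest: borel_measurable_integrable)
  then have "(\<lambda>x. (weight \<alpha> x * f x) / weight \<alpha> x) \<in> borel_measurable borel"
    by measurable
  moreover have "(\<lambda>x. (weight \<alpha> x * f x) / weight \<alpha> x) = f"
    using weight_pos[of \<alpha>] by (auto simp: fun_eq_iff less_le)
  ultimately show ?thesis by simp
qed

lemma wL1_abs: "wL1 \<alpha> f \<Longrightarrow> integrable lborel (\<lambda>x. weight \<alpha> x * \<bar>f x\<bar>)"
  unfolding wL1_def by (drule integrable_abs) (simp add: abs_mult weight_pos less_imp_le)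

lemma wL1_add: "wL1 \<alpha> f \<Longrightarrow> wL1 \<alpha> g \<Longrightarrow> wL1 \<alpha> (\<lambda>x. f x + g x)"
  by (simp add: wL1_def distrib_left)

lemma wL1_diff: "wL1 \<alpha> f \<Longrightarrow> wL1 \<alpha> g \<Longrightarrow> wL1 \<alpha> (\<lambda>x. f x - g x)"
  by (simp add: wL1_def right_diff_distrib)

lemma wL1_cmult: "wL1 \<alpha> f \<Longrightarrow> wL1 \<alpha> (\<lambda>x. c * f x)"
  by (simp add: wL1_def mult.left_commute)

lemma wnorm_nonneg: "0 \<le> wnorm \<alpha> f"
  by (auto simp: wnorm_def weight_pos less_imp_le)

lemma wnorm_add_le:
  assumes "wL1 \<alpha> f" "wL1 \<alpha> g"
  shows "wnorm \<alpha> (\<lambda>x. f x + g x) \<le> wnorm \<alpha> f + wnorm \<alpha> g"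
proof -
  have "wnorm \<alpha> (\<lambda>x. f x + g x) \<le> (\<integral>x. weight \<alpha> x * \<bar>f x\<bar> + weight \<alpha> x * \<bar>g x\<bar> \<partial>lborel)"
    unfolding wnorm_def
    by (intro integral_mono wL1_abs[OF wL1_add] Bochner_Integration.integrable_add wL1_abs assms,
        unfold distrib_left[symmetric])
      (intro mult_left_mono abs_triangle_ineq, simp add: weight_pos less_imp_le)
  then show ?thesis
    using assms by (simp add: wnorm_def wL1_abs)
qed

lemma wnorm_cmult: "wnorm \<alpha> (\<lambda>x. c * f x) = \<bar>c\<bar> * wnorm \<alpha> f"
  by (simp add: wnorm_def abs_mult mult.left_commute)

definition kernel_form :: "real \<Rightarrow> (real \<Rightarrow> real) \<Rightarrow> (real \<Rightarrow> real) \<Rightarrow> real" where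
  "kernel_form \<alpha> f g = (\<integral>z. \<bar>fst z - snd z\<bar> powr \<alpha> * f (fst z) * g (snd z) \<partial>(lborel \<Otimes>\<^sub>M lborel))"

lemma integrable_product_lborel:
  fixes f g :: "real \<Rightarrow> real"
  assumes f: "integrable lborel f" and g: "integrable lborel g"
  shows "integrable (lborel \<Otimes>\<^sub>M lborel) (\<lambda>z. f (fst z) * g (snd z))"
    and "(\<integral>z. f (fst z) * g (snd z) \<partial>(lborel \<Otimes>\<^sub>M lborel)) = (\<integral>x. f x \<partial>lborel) * (\<integral>x. g x \<partial>lborel)"
proof -
  have [measurable]: "f \<in> borel_measurable borel" "g \<in> borel_measurable borel"
    using assms[THEN borel_measurable_integrable] by auto
  show int: "integrable (lborel \<Otimes>\<^sub>M lborel) (\<lambda>z. f (fst z) * g (snd z))"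
  proof (rule lborel_pair.Fubini_integrable)
    show "integrable lborel (\<lambda>x. \<integral>y. norm (f (fst (x, y)) * g (snd (x, y))) \<partial>lborel)"
      using f by (simp add: abs_mult)
    show "AE x in lborel. integrable lborel (\<lambda>y. f (fst (x, y)) * g (snd (x, y)))"
      using g by simp
  qed measurable
  show "(\<integral>z. f (fst z) * g (snd z) \<partial>(lborel \<Otimes>\<^sub>M lborel)) = (\<integral>x. f x \<partial>lborel) * (\<integral>x. g x \<partial>lborel)"
    using lborel_pair.integral_fst'[OF int] by simp
qed

lemma
  assumes \<alpha>: "0 \<le> \<alpha>" and f: "wL1 \<alpha> f" and g: "wL1 \<alpha> g"
  shows kernel_form_integrable:
      "integrable (lborel \<Otimes>\<^sub>M lborel) (\<lambda>z. \<bar>fst z - snd z\<bar> powr \<alpha> * f (fst z) * g (snd z))"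
    and kernel_form_bound: "\<bar>kernel_form \<alpha> f g\<bar> \<le> 2 powr \<alpha> * (wnorm \<alpha> f * wnorm \<alpha> g)"
proof -
  have [measurable]: "f \<in> borel_measurable borel" "g \<in> borel_measurable borel"
    using f g by (auto dest: wL1_measurable)
  let ?k = "\<lambda>z. \<bar>fst z - snd z\<bar> powr \<alpha> * f (fst z) * g (snd z)"
  let ?b = "\<lambda>z. 2 powr \<alpha> * ((weight \<alpha> (fst z) * \<bar>f (fst z)\<bar>) * (weight \<alpha> (snd z) * \<bar>g (snd z)\<bar>))"
  note prod = integrable_product_lborel[OF wL1_abs[OF f] wL1_abs[OF g]]
  have b: "integrable (lborel \<Otimes>\<^sub>M lborel) ?b"
    using prod(1) by simp
  have le: "\<bar>?k z\<bar> \<le> ?b z" for z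
  proof -
    have "\<bar>?k z\<bar> = \<bar>fst z - snd z\<bar> powr \<alpha> * (\<bar>f (fst z)\<bar> * \<bar>g (snd z)\<bar>)"
      by (simp add: abs_mult)
    also have "\<dots> \<le> (2 powr \<alpha> * (weight \<alpha> (fst z) * weight \<alpha> (snd z))) * (\<bar>f (fst z)\<bar> * \<bar>g (snd z)\<bar>)"
      by (intro mult_right_mono kernel_le_weight \<alpha>) auto
    finally show ?thesis by (simp add: ac_simps)
  qed
  show k: "integrable (lborel \<Otimes>\<^sub>M lborel) ?k"
    by (rule Bochner_Integration.integrable_bound[OF b]) (auto intro!: AE_I2 order_trans[OF le])
  have "\<bar>kernel_form \<alpha> f g\<bar> \<le> (\<integral>z. \<bar>?k z\<bar> \<partial>(lborel \<Otimes>\<^sub>M lborel))"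
    unfolding kernel_form_def by (rule integral_abs_bound)
  also have "\<dots> \<le> (\<integral>z. ?b z \<partial>(lborel \<Otimes>\<^sub>M lborel))"
    by (intro integral_mono b integrable_abs k le)
  also have "\<dots> = 2 powr \<alpha> * (wnorm \<alpha> f * wnorm \<alpha> g)"
    using prod(2) by (simp add: wnorm_def)
  finally show "\<bar>kernel_form \<alpha> f g\<bar> \<le> 2 powr \<alpha> * (wnorm \<alpha> f * wnorm \<alpha> g)" .
qed

lemma kernel_form_sym:
  assumes [measurable]: "f \<in> borel_measurable borel" "g \<in> borel_measurable borel"
  shows "kernel_form \<alpha> f g = kernel_form \<alpha> g f"
  using lborel_pair.integral_product_swap[of "\<lambda>z. \<bar>fst z - snd z\<bar> powr \<alpha> * f (fst z) * g (snd z)"]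
  by (simp add: kernel_form_def abs_minus_commute ac_simps split_beta')

lemma kernel_form_add_left:
  assumes "0 \<le> \<alpha>" "wL1 \<alpha> f" "wL1 \<alpha> f'" "wL1 \<alpha> g"
  shows "kernel_form \<alpha> (\<lambda>x. f x + f' x) g = kernel_form \<alpha> f g + kernel_form \<alpha> f' g"
  using kernel_form_integrable[OF assms(1,2,4)] kernel_form_integrable[OF assms(1,3,4)]
  by (simp add: kernel_form_def algebra_simps)

lemma kernel_form_cmult_left: "kernel_form \<alpha> (\<lambda>x. c * f x) g = c * kernel_form \<alpha> f g"
proof -
  have "kernel_form \<alpha> (\<lambda>x. c * f x) g
      = (\<integral>z. c * (\<bar>fst z - snd z\<bar> powr \<alpha> * f (fst z) * g (snd z)) \<partial>(lborel \<Otimes>\<^sub>M lborel))"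
    unfolding kernel_form_def by (intro Bochner_Integration.integral_cong) auto
  then show ?thesis by (simp add: kernel_form_def)
qed

lemma kernel_form_add_right:
  assumes "0 \<le> \<alpha>" "wL1 \<alpha> f" "wL1 \<alpha> g" "wL1 \<alpha> g'"
  shows "kernel_form \<alpha> f (\<lambda>x. g x + g' x) = kernel_form \<alpha> f g + kernel_form \<alpha> f g'"
  using kernel_form_integrable[OF assms(1,2,3)] kernel_form_integrable[OF assms(1,2,4)]
  by (simp add: kernel_form_def algebra_simps)

lemma kernel_form_cmult_right: "kernel_form \<alpha> f (\<lambda>x. c * g x) = c * kernel_form \<alpha> f g"
proof -
  have "kernel_form \<alpha> f (\<lambda>x. c * g x)
      = (\<integral>z. c * (\<bar>fst z - snd z\<bar> powr \<alpha> * f (fst z) * g (snd z)) \<partial>(lborel \<Otimes>\<^sub>M lborel))"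
    unfolding kernel_form_def by (intro Bochner_Integration.integral_cong) auto
  then show ?thesis by (simp add: kernel_form_def)
qed

text \<open>The density of \<open>m + s * Z\<close> when \<open>Z\<close> has density \<open>f\<close>; it is applied to signed functions as well.\<close>

definition push :: "real \<Rightarrow> real \<Rightarrow> (real \<Rightarrow> real) \<Rightarrow> real \<Rightarrow> real" where
  "push m s f x = f ((x - m) / s) / s"

lemma push_affine: "0 < s \<Longrightarrow> push m s f (m + s * z) = f z / s"
  by (simp add: push_def)

lemma wL1_push:
  assumes \<alpha>: "0 \<le> \<alpha>" and f: "wL1 \<alpha> f" and s: "0 < s"
  shows "wL1 \<alpha> (push m s f)"
proof -
  have [measurable]: "f \<in> borel_measurable borel"
    using f by (rule wL1_measurable)
  let ?K = "1 + 2 powr \<alpha> * (\<bar>m\<bar> powr \<alpha> + \<bar>s\<bar> powr \<alpha>)"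
  have K: "0 \<le> ?K" by (intro add_nonneg_nonneg mult_nonneg_nonneg) auto
  have "integrable lborel (\<lambda>z. (weight \<alpha> (m + s * z) * f z) / s)"
  proof (intro integrable_divide, rule Bochner_Integration.integrable_bound)
    show "integrable lborel (\<lambda>z. ?K * (weight \<alpha> z * \<bar>f z\<bar>))"
      using wL1_abs[OF f] by simp
    have "norm (weight \<alpha> (m + s * z) * f z) \<le> norm (?K * (weight \<alpha> z * \<bar>f z\<bar>))" for z
      using mult_right_mono[OF weight_affine_le[OF \<alpha> order_refl order_refl, of m s z], of "\<bar>f z\<bar>"]
        weight_pos[of \<alpha>] K
      by (simp add: abs_mult abs_of_pos abs_of_nonneg ac_simps)
    then show "AE z in lborel. norm (weight \<alpha> (m + s * z) * f z) \<le> norm (?K * (weight \<alpha> z * \<bar>f z\<bar>))"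
      by simp
  qed measurable
  then show ?thesis
    using lborel_integrable_real_affine_iff[of s "\<lambda>x. weight \<alpha> x * push m s f x" m] s
    by (simp add: wL1_def push_affine)
qed

text \<open>Substitution moves the affine map into the kernel, where the shift cancels and the scale comes
  out as \<open>s powr \<alpha>\<close>. This is the source of the exponent in the scaling law.\<close>

lemma kernel_form_push:
  assumes \<alpha>: "0 \<le> \<alpha>" and f: "wL1 \<alpha> f" and g: "wL1 \<alpha> g" and s: "0 < s"
  shows "kernel_form \<alpha> (push m s f) (push m s g) = s powr \<alpha> * kernel_form \<alpha> f g"
proof -
  have iter: "kernel_form \<alpha> f g = (\<integral>x. \<integral>y. \<bar>x - y\<bar> powr \<alpha> * f x * g y \<partial>lborel \<partial>lborel)"
    if "wL1 \<alpha> f" "wL1 \<alpha> g" for f g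
    using lborel_pair.integral_fst'[OF kernel_form_integrable[OF \<alpha> that]] by (simp add: kernel_form_def)
  have dist: "\<bar>m + s * x - (m + s * y)\<bar> powr \<alpha> = s powr \<alpha> * \<bar>x - y\<bar> powr \<alpha>" for x y
  proof -
    have "m + s * x - (m + s * y) = s * (x - y)" by (simp add: algebra_simps)
    then show ?thesis using s by (simp add: abs_mult powr_mult)
  qed
  have "kernel_form \<alpha> (push m s f) (push m s g)
      = (\<integral>x. \<integral>y. \<bar>x - y\<bar> powr \<alpha> * push m s f x * push m s g y \<partial>lborel \<partial>lborel)"
    by (intro iter wL1_push \<alpha> f g s)
  also have "\<dots> = s * (\<integral>x. \<integral>y. \<bar>m + s * x - y\<bar> powr \<alpha> * (f x / s) * push m s g y \<partial>lborel \<partial>lborel)"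
    using s by (subst lborel_integral_real_affine[where c=s and t=m]) (auto simp: push_affine)
  also have "\<dots> = s * (\<integral>x. s * (\<integral>y. \<bar>m + s * x - (m + s * y)\<bar> powr \<alpha> * (f x / s) * (g y / s) \<partial>lborel) \<partial>lborel)"
    using s by (subst (2) lborel_integral_real_affine[where c=s and t=m]) (auto simp: push_affine)
  also have "\<dots> = s * (\<integral>x. s * (\<integral>y. (s powr \<alpha> / (s * s)) * (\<bar>x - y\<bar> powr \<alpha> * f x * g y) \<partial>lborel) \<partial>lborel)"
    by (simp only: dist) (simp add: ac_simps)
  also have "\<dots> = s powr \<alpha> * kernel_form \<alpha> f g"
    using s by (simp add: iter[OF f g])
  finally show ?thesis .
qed

section \<open>First order expansion of an affinely transformed density\<close>

lemma continuous_on_weight: "0 < \<alpha> \<Longrightarrow> continuous_on UNIV (weight \<alpha>)"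
  unfolding weight_def by (intro continuous_intros continuous_on_powr') auto

lemma wnorm_scaled_push:
  assumes "0 < s"
  shows "wnorm \<alpha> (\<lambda>x. push m s f x / s) = (\<integral>z. weight \<alpha> (m + s * z) * \<bar>f z\<bar> \<partial>lborel) / s"
proof -
  have "wnorm \<alpha> (\<lambda>x. push m s f x / s)
      = s * (\<integral>z. (weight \<alpha> (m + s * z) * \<bar>f z\<bar>) / (s * s) \<partial>lborel)"
    unfolding wnorm_def using assms
    by (subst lborel_integral_real_affine[where c=s and t=m]) (auto simp: push_affine abs_of_pos)
  then show ?thesis using assms by simp
qed

lemma nn_integral_wnorm:
  assumes "wL1 \<alpha> f"
  shows "(\<integral>\<^sup>+x. ennreal (weight \<alpha> x * \<bar>f x\<bar>) \<partial>lborel) = ennreal (wnorm \<alpha> f)"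
  unfolding wnorm_def using wL1_abs[OF assms]
  by (intro nn_integral_eq_integral) (auto simp: weight_pos less_imp_le)

lemma scaled_push_wL1:
  assumes "0 \<le> \<alpha>" "wL1 \<alpha> f" "0 < s"
  shows "wL1 \<alpha> (\<lambda>x. push m s f x / s)"
  using wL1_cmult[OF wL1_push[OF assms], of "1 / s"] by simp

text \<open>The norms converge by dominated convergence, because an affine substitution moves the varying
  parameters from \<open>f\<close> to the continuous weight. Together with pointwise convergence, Scheffe's lemma
  upgrades this to convergence in norm. The additional division by \<open>s\<close> appears because the
  parameter derivatives of \<open>push m s q\<close> carry the factor \<open>1 / s\<^sup>2\<close>.\<close>

lemma tendsto_scaled_push:
  assumes \<alpha>: "0 < \<alpha>" and f: "wL1 \<alpha> f" and cont: "continuous_on UNIV f"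
    and m: "m \<longlonglongrightarrow> 0" and s: "s \<longlonglongrightarrow> 1" and s_pos: "\<And>n. 0 < s n"
  shows "(\<lambda>n. wnorm \<alpha> (\<lambda>x. push (m n) (s n) f x / s n - f x)) \<longlonglongrightarrow> 0"
proof -
  have \<alpha>0: "0 \<le> \<alpha>" using \<alpha> by simp
  have [measurable]: "f \<in> borel_measurable borel"
    using f by (rule wL1_measurable)
  let ?F = "\<lambda>n x. weight \<alpha> x * (push (m n) (s n) f x / s n)"
  have F: "wL1 \<alpha> (\<lambda>x. push (m n) (s n) f x / s n)" for n
    by (intro scaled_push_wL1 \<alpha>0 f s_pos)
  obtain a where a: "\<And>n. \<bar>m n\<bar> \<le> a"
    using convergent_imp_Bseq[of m] m by (auto simp: convergent_def Bseq_def)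
  obtain b where b: "\<And>n. \<bar>s n\<bar> \<le> b"
    using convergent_imp_Bseq[of s] s by (auto simp: convergent_def Bseq_def)
  let ?K = "1 + 2 powr \<alpha> * (a powr \<alpha> + b powr \<alpha>)"
  have "(\<lambda>n. \<integral>z. weight \<alpha> (m n + s n * z) * \<bar>f z\<bar> \<partial>lborel) \<longlonglongrightarrow> (\<integral>z. weight \<alpha> z * \<bar>f z\<bar> \<partial>lborel)"
  proof (rule integral_dominated_convergence[where w="\<lambda>z. ?K * (weight \<alpha> z * \<bar>f z\<bar>)"])
    show "integrable lborel (\<lambda>z. ?K * (weight \<alpha> z * \<bar>f z\<bar>))"
      using wL1_abs[OF f] by simp
    have "(\<lambda>n. weight \<alpha> (m n + s n * z)) \<longlonglongrightarrow> weight \<alpha> (0 + 1 * z)" for z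
      using continuous_on_weight[OF \<alpha>]
      by (intro isCont_tendsto_compose[of _ "weight \<alpha>"] tendsto_intros m s)
        (simp add: continuous_on_eq_continuous_at)
    then show "AE z in lborel. (\<lambda>n. weight \<alpha> (m n + s n * z) * \<bar>f z\<bar>) \<longlonglongrightarrow> weight \<alpha> z * \<bar>f z\<bar>"
      by (auto intro!: AE_I2 tendsto_mult_right)
    show "AE z in lborel. norm (weight \<alpha> (m n + s n * z) * \<bar>f z\<bar>) \<le> ?K * (weight \<alpha> z * \<bar>f z\<bar>)" for n
    proof (rule AE_I2)
      fix z
      show "norm (weight \<alpha> (m n + s n * z) * \<bar>f z\<bar>) \<le> ?K * (weight \<alpha> z * \<bar>f z\<bar>)"
        using mult_right_mono[OF weight_affine_le[OF \<alpha>0 a b, of n n z], of "\<bar>f z\<bar>"]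
          weight_pos[of \<alpha>]
        by (simp add: abs_mult abs_of_pos ac_simps)
    qed
  qed measurable
  then have "(\<lambda>n. wnorm \<alpha> (\<lambda>x. push (m n) (s n) f x / s n)) \<longlonglongrightarrow> wnorm \<alpha> f / 1"
    unfolding wnorm_scaled_push[OF s_pos] by (intro tendsto_intros s) (simp_all add: wnorm_def)
  then have lim: "(\<lambda>n. ennreal (wnorm \<alpha> (\<lambda>x. push (m n) (s n) f x / s n))) \<longlonglongrightarrow> ennreal (wnorm \<alpha> f)"
    by (intro tendsto_ennrealI) simp
  have norm_w: "norm (weight \<alpha> x * y) = weight \<alpha> x * \<bar>y\<bar>" for x y
    by (simp add: abs_mult weight_pos less_imp_le)
  have "(\<lambda>n. \<integral>\<^sup>+x. norm (?F n x - weight \<alpha> x * f x) \<partial>lborel) \<longlonglongrightarrow> 0"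
  proof (rule Scheffe_lemma1)
    show "integrable lborel (?F n)" for n
      using F[of n] by (simp add: wL1_def)
    show "integrable lborel (\<lambda>x. weight \<alpha> x * f x)"
      using f by (simp add: wL1_def)
    show "AE x in lborel. (\<lambda>n. ?F n x) \<longlonglongrightarrow> weight \<alpha> x * f x"
    proof (rule AE_I2)
      fix x
      have "(\<lambda>n. f ((x - m n) / s n)) \<longlonglongrightarrow> f ((x - 0) / 1)"
        using cont by (intro isCont_tendsto_compose[of _ f] tendsto_intros m s)
          (auto simp: continuous_on_eq_continuous_at)
      then have "(\<lambda>n. ?F n x) \<longlonglongrightarrow> weight \<alpha> x * (f ((x - 0) / 1) / 1 / 1)"
        unfolding push_def by (intro tendsto_intros s) auto
      then show "(\<lambda>n. ?F n x) \<longlonglongrightarrow> weight \<alpha> x * f x" by simp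
    qed
    show "limsup (\<lambda>n. \<integral>\<^sup>+x. norm (?F n x) \<partial>lborel) \<le> (\<integral>\<^sup>+x. norm (weight \<alpha> x * f x) \<partial>lborel)"
      unfolding norm_w nn_integral_wnorm[OF F] nn_integral_wnorm[OF f]
      using lim_imp_Limsup[OF _ lim] by simp
  qed
  moreover have "(\<lambda>n. \<integral>\<^sup>+x. norm (?F n x - weight \<alpha> x * f x) \<partial>lborel)
      = (\<lambda>n. ennreal (wnorm \<alpha> (\<lambda>x. push (m n) (s n) f x / s n - f x)))"
    unfolding right_diff_distrib[symmetric] norm_w
    by (intro ext nn_integral_wnorm wL1_diff F f)
  ultimately have "(\<lambda>n. ennreal (wnorm \<alpha> (\<lambda>x. push (m n) (s n) f x / s n - f x))) \<longlonglongrightarrow> ennreal 0"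
    by simp
  then show ?thesis
    by (subst (asm) tendsto_ennreal_iff) (auto simp: wnorm_nonneg)
qed

lemma scaled_push_near:
  assumes \<alpha>: "0 < \<alpha>" and f: "wL1 \<alpha> f" and cont: "continuous_on UNIV f" and \<epsilon>: "0 < \<epsilon>"
  shows "\<exists>\<delta>>0. \<forall>m t. \<bar>m\<bar> < \<delta> \<longrightarrow> \<bar>t\<bar> < \<delta> \<longrightarrow>
    wnorm \<alpha> (\<lambda>x. push m (1 + t) f x / (1 + t) - f x) < \<epsilon>"
proof (rule ccontr)
  assume neg: "\<not> ?thesis"
  have "\<exists>m t. \<bar>m\<bar> < inverse (real (Suc n)) \<and> \<bar>t\<bar> < inverse (real (Suc n)) \<and>
      \<epsilon> \<le> wnorm \<alpha> (\<lambda>x. push m (1 + t) f x / (1 + t) - f x)" for n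
  proof -
    have "0 < inverse (real (Suc n))" by simp
    with neg show ?thesis by (meson not_less)
  qed
  then obtain m t where mt: "\<And>n. \<bar>m n\<bar> < inverse (real (Suc n))" "\<And>n. \<bar>t n\<bar> < inverse (real (Suc n))"
      and far: "\<And>n. \<epsilon> \<le> wnorm \<alpha> (\<lambda>x. push (m n) (1 + t n) f x / (1 + t n) - f x)"
    by metis
  have lim: "(\<lambda>n. inverse (real (Suc n))) \<longlonglongrightarrow> 0"
    by (rule LIMSEQ_inverse_real_of_nat)
  have m: "m \<longlonglongrightarrow> 0" and t: "t \<longlonglongrightarrow> 0"
    using mt by (auto intro!: Lim_null_comparison[OF _ lim] always_eventually less_imp_le)
  have "0 < 1 + t n" for n
  proof -
    have "inverse (real (Suc n)) \<le> 1" by (simp add: inverse_le_1_iff)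
    then show ?thesis using mt(2)[of n] by linarith
  qed
  moreover have "(\<lambda>n. 1 + t n) \<longlonglongrightarrow> 1"
    using tendsto_add[OF tendsto_const t, of 1] by simp
  ultimately have "(\<lambda>n. wnorm \<alpha> (\<lambda>x. push (m n) (1 + t n) f x / (1 + t n) - f x)) \<longlonglongrightarrow> 0"
    by (intro tendsto_scaled_push \<alpha> f cont m)
  then have "\<epsilon> \<le> 0"
    by (rule LIMSEQ_le_const) (use far in auto)
  with \<epsilon> show False by simp
qed

text \<open>The quotient rule applied to \<open>q (Z u) / C u\<close>, rearranged into the two directions \<open>m\<close> and \<open>t\<close>;
  here \<open>A\<close> and \<open>B\<close> stand for the values of \<open>q'\<close> and \<open>q\<close> at \<open>Z = (x - u * m) / C\<close>, where \<open>C = 1 + u * t\<close>.\<close>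

lemma dilation_derivative_algebra:
  fixes A B C Z G1 G2 m t :: real
  assumes "C \<noteq> 0"
  shows "(A * ((- m * C - C * Z * t) / (C * C)) * C - B * t) / (C * C) + (m * G1 + t * G2)
    = m * (G1 - A / C / C) + t * (G2 - (B + Z * A) / C / C)"
proof -
  define I where "I = inverse (C * C)"
  have I: "X / (C * C) = X * I" "X / C / C = X * I" for X
    by (simp_all add: I_def divide_inverse)
  have "A * ((- m * C - C * Z * t) / (C * C)) * C = A * (- m - Z * t)"
    using assms by (simp add: field_simps)
  then show ?thesis unfolding I(1)[of "_ - B * t"] I(2) by (simp only:) (simp add: algebra_simps)
qed
text \<open>The integral form of the remainder along the segment from \<open>(0, 1)\<close> to \<open>(m, 1 + t)\<close>. The integrand
  is the difference between the derivative at the start of the segment and at the point with parameter \<open>u\<close>.\<close>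

lemma push_taylor:
  assumes q: "\<And>x. (q has_real_derivative q' x) (at x)" and q': "continuous_on UNIV q'"
    and t: "\<bar>t\<bar> < 1"
  defines "g1 \<equiv> q'" and "g2 \<equiv> (\<lambda>x. q x + x * q' x)"
  shows "push m (1 + t) q x - q x + (m * g1 x + t * g2 x) =
    (\<integral>u. (m * (g1 x - push (u * m) (1 + u * t) g1 x / (1 + u * t))
        + t * (g2 x - push (u * m) (1 + u * t) g2 x / (1 + u * t))) * indicator {0..1} u \<partial>lborel)"
proof -
  let ?z = "\<lambda>u. (x - u * m) / (1 + u * t)"
  let ?F = "\<lambda>u. q (?z u) / (1 + u * t) + u * (m * g1 x + t * g2 x)"
  have pos: "0 < 1 + u * t" if "0 \<le> u" "u \<le> 1" for u
  proof -
    have "\<bar>u * t\<bar> \<le> 1 * \<bar>t\<bar>" using that by (simp only: abs_mult) (intro mult_right_mono, auto)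
    with t show ?thesis by linarith
  qed
  have cont_q: "isCont q y" "isCont q' y" for y
    using q DERIV_isCont q' by (auto simp: continuous_on_eq_continuous_at)
  have "(\<integral>u. (m * (g1 x - push (u * m) (1 + u * t) g1 x / (1 + u * t))
        + t * (g2 x - push (u * m) (1 + u * t) g2 x / (1 + u * t))) * indicator {0..1} u \<partial>lborel)
      = ?F 1 - ?F 0"
  proof (rule integral_FTC_Icc_real[where F = ?F])
    fix u :: real assume u: "0 \<le> u" "u \<le> 1"
    let ?c = "1 + u * t"
    have c: "0 < ?c" using pos[OF u] .
    have "((\<lambda>u. q (?z u)) has_real_derivative q' (?z u) * ((- m * ?c - (x - u * m) * t) / (?c * ?c))) (at u)"
      using c by (intro DERIV_chain2[OF q]) (auto intro!: derivative_eq_intros)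
    moreover have "((\<lambda>u. 1 + u * t) has_real_derivative t) (at u)"
      by (auto intro!: derivative_eq_intros)
    moreover have "((\<lambda>u. u * (m * g1 x + t * g2 x)) has_real_derivative m * g1 x + t * g2 x) (at u)"
      by (rule DERIV_cmult_right[OF DERIV_ident, simplified])
    ultimately have D: "(?F has_real_derivative
        (q' (?z u) * ((- m * ?c - (x - u * m) * t) / (?c * ?c)) * ?c - q (?z u) * t) / (?c * ?c)
        + (m * g1 x + t * g2 x)) (at u)"
      using c by (intro DERIV_add DERIV_divide) auto
    have "(q' (?z u) * ((- m * ?c - (x - u * m) * t) / (?c * ?c)) * ?c - q (?z u) * t) / (?c * ?c)
        + (m * g1 x + t * g2 x)
        = m * (g1 x - push (u * m) ?c g1 x / ?c) + t * (g2 x - push (u * m) ?c g2 x / ?c)"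
    proof -
      have "?c * ?z u = x - u * m" using c by simp
      moreover have "?c \<noteq> 0" using c by simp
      note dilation_derivative_algebra[OF this, where A="q' (?z u)" and B="q (?z u)" and Z="?z u"
          and m=m and t=t and ?G1.0="g1 x" and ?G2.0="g2 x"]
      ultimately show ?thesis
        unfolding push_def g1_def g2_def by (simp only:)
    qed
    with D show "(?F has_real_derivative
        m * (g1 x - push (u * m) ?c g1 x / ?c) + t * (g2 x - push (u * m) ?c g2 x / ?c)) (at u)"
      by (rule DERIV_cong)
    have z: "isCont ?z u" using c by (intro continuous_intros) auto
    show "isCont (\<lambda>u. m * (g1 x - push (u * m) (1 + u * t) g1 x / (1 + u * t))
        + t * (g2 x - push (u * m) (1 + u * t) g2 x / (1 + u * t))) u"
      unfolding push_def g1_def g2_def using c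
      by (intro isCont_diff isCont_add isCont_mult isCont_divide continuous_const continuous_ident
          isCont_o2[OF z] cont_q z) auto
  qed simp
  then show ?thesis by (simp add: push_def)
qed

text \<open>By Fubini the norm of the remainder is at most the average over the segment of the norms of the
  differences of derivatives.\<close>

lemma wnorm_push_remainder_le:
  assumes \<alpha>: "0 \<le> \<alpha>" and q: "\<And>x. (q has_real_derivative q' x) (at x)"
    and q': "continuous_on UNIV q'" and t: "\<bar>t\<bar> < 1"
  defines "g1 \<equiv> q'" and "g2 \<equiv> (\<lambda>x. q x + x * q' x)"
  assumes w: "wL1 \<alpha> q" "wL1 \<alpha> g1" "wL1 \<alpha> g2"
    and near: "\<And>u g. 0 \<le> u \<Longrightarrow> u \<le> 1 \<Longrightarrow> g = g1 \<or> g = g2 \<Longrightarrow>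
      wnorm \<alpha> (\<lambda>x. push (u * m) (1 + u * t) g x / (1 + u * t) - g x) \<le> \<epsilon>"
  shows "wnorm \<alpha> (\<lambda>x. push m (1 + t) q x - q x + (m * g1 x + t * g2 x)) \<le> (\<bar>m\<bar> + \<bar>t\<bar>) * \<epsilon>"
proof -
  have [measurable]: "q \<in> borel_measurable borel" "g1 \<in> borel_measurable borel" "g2 \<in> borel_measurable borel"
    using w by (auto dest: wL1_measurable)
  define e where "e = (\<lambda>x. push m (1 + t) q x - q x + (m * g1 x + t * g2 x))"
  define k where "k = (\<lambda>g u x. push (u * m) (1 + u * t) g x / (1 + u * t) - g x)"
  have [measurable]: "(\<lambda>(x, u). k g u x) \<in> borel_measurable (borel \<Otimes>\<^sub>M borel)"
    if [measurable]: "g \<in> borel_measurable borel" for g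
    unfolding k_def push_def by measurable
  have pos: "0 < 1 + u * t" if "0 \<le> u" "u \<le> 1" for u
  proof -
    have "\<bar>u * t\<bar> \<le> 1 * \<bar>t\<bar>" using that by (simp only: abs_mult) (intro mult_right_mono, auto)
    with t show ?thesis by linarith
  qed
  have \<epsilon>: "0 \<le> \<epsilon>"
    using order_trans[OF wnorm_nonneg near[of 0 g1]] by auto
  have e_w: "wL1 \<alpha> e"
    unfolding e_def using t by (intro wL1_add wL1_diff wL1_cmult wL1_push \<alpha> w) auto
  define h where "h = (\<lambda>x u. (\<bar>m\<bar> * (weight \<alpha> x * \<bar>k g1 u x\<bar>) + \<bar>t\<bar> * (weight \<alpha> x * \<bar>k g2 u x\<bar>)) * indicator {0..1} u)"
  have h_meas [measurable]: "(\<lambda>(x, u). ennreal (h x u)) \<in> borel_measurable (lborel \<Otimes>\<^sub>M lborel)"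
    unfolding h_def by (measurable; simp add: split_beta')
  have "ennreal (wnorm \<alpha> e) = (\<integral>\<^sup>+x. ennreal (weight \<alpha> x * \<bar>e x\<bar>) \<partial>lborel)"
    by (rule nn_integral_wnorm[OF e_w, symmetric])
  also have "\<dots> \<le> (\<integral>\<^sup>+x. (\<integral>\<^sup>+u. ennreal (h x u) \<partial>lborel) \<partial>lborel)"
  proof (rule nn_integral_mono)
    fix x :: real
    let ?d = "\<lambda>u. (m * (g1 x - push (u * m) (1 + u * t) g1 x / (1 + u * t))
        + t * (g2 x - push (u * m) (1 + u * t) g2 x / (1 + u * t))) * indicator {0..1} u"
    have "e x = (\<integral>u. ?d u \<partial>lborel)"
      unfolding e_def g1_def g2_def by (rule push_taylor[OF q q' t])
    then have "ennreal (weight \<alpha> x * \<bar>e x\<bar>) = ennreal (norm (\<integral>u. weight \<alpha> x * ?d u \<partial>lborel))"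
      by (simp add: abs_mult weight_pos less_imp_le)
    also have "\<dots> \<le> (\<integral>\<^sup>+u. ennreal (norm (weight \<alpha> x * ?d u)) \<partial>lborel)"
    proof (cases "integrable lborel (\<lambda>u. weight \<alpha> x * ?d u)")
      case False
      show ?thesis
        by (simp only: not_integrable_integral_eq[OF False] norm_zero ennreal_0 zero_le)
    qed (rule integral_norm_bound_ennreal)
    also have "\<dots> \<le> (\<integral>\<^sup>+u. ennreal (h x u) \<partial>lborel)"
    proof (intro nn_integral_mono ennreal_leI)
      fix u :: real
      have "\<bar>m * (- k g1 u x) + t * (- k g2 u x)\<bar> \<le> \<bar>m\<bar> * \<bar>k g1 u x\<bar> + \<bar>t\<bar> * \<bar>k g2 u x\<bar>"
        using abs_triangle_ineq[of "m * (- k g1 u x)" "t * (- k g2 u x)"] by (simp add: abs_mult)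
      then have "weight \<alpha> x * \<bar>m * (- k g1 u x) + t * (- k g2 u x)\<bar>
          \<le> weight \<alpha> x * (\<bar>m\<bar> * \<bar>k g1 u x\<bar> + \<bar>t\<bar> * \<bar>k g2 u x\<bar>)"
        by (intro mult_left_mono less_imp_le[OF weight_pos])
      also have "\<dots> = \<bar>m\<bar> * (weight \<alpha> x * \<bar>k g1 u x\<bar>) + \<bar>t\<bar> * (weight \<alpha> x * \<bar>k g2 u x\<bar>)"
        by (simp only: distrib_left mult.left_commute)
      finally have "weight \<alpha> x * \<bar>m * (- k g1 u x) + t * (- k g2 u x)\<bar> * indicator {0..1} u \<le> h x u"
        unfolding h_def by (rule mult_right_mono) simp
      moreover have "?d u = (m * (- k g1 u x) + t * (- k g2 u x)) * indicator {0..1} u"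
        by (simp add: k_def)
      then have "norm (weight \<alpha> x * ?d u)
          = weight \<alpha> x * \<bar>m * (- k g1 u x) + t * (- k g2 u x)\<bar> * indicator {0..1} u"
        by (simp only: real_norm_def abs_mult abs_of_pos[OF weight_pos] mult.assoc abs_indicator)
      ultimately show "norm (weight \<alpha> x * ?d u) \<le> h x u"
        by simp
    qed
    finally show "ennreal (weight \<alpha> x * \<bar>e x\<bar>) \<le> (\<integral>\<^sup>+u. ennreal (h x u) \<partial>lborel)" .
  qed
  also have "\<dots> = (\<integral>\<^sup>+u. (\<integral>\<^sup>+x. ennreal (h x u) \<partial>lborel) \<partial>lborel)"
    using lborel_pair.Fubini'[OF h_meas] by simp
  also have "\<dots> \<le> (\<integral>\<^sup>+u. ennreal ((\<bar>m\<bar> + \<bar>t\<bar>) * \<epsilon>) * indicator {0..1::real} u \<partial>lborel)"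
  proof (rule nn_integral_mono)
    fix u :: real
    show "(\<integral>\<^sup>+x. ennreal (h x u) \<partial>lborel) \<le> ennreal ((\<bar>m\<bar> + \<bar>t\<bar>) * \<epsilon>) * indicator {0..1} u"
    proof (cases "u \<in> {0..1}")
      case True
      then have u: "0 \<le> u" "u \<le> 1" by auto
      have kw: "wL1 \<alpha> (k g1 u)" "wL1 \<alpha> (k g2 u)"
        unfolding k_def by (intro wL1_diff scaled_push_wL1 \<alpha> w pos u)+
      have "(\<integral>\<^sup>+x. ennreal (h x u) \<partial>lborel)
          = ennreal (\<integral>x. \<bar>m\<bar> * (weight \<alpha> x * \<bar>k g1 u x\<bar>) + \<bar>t\<bar> * (weight \<alpha> x * \<bar>k g2 u x\<bar>) \<partial>lborel)"
        using True kw[THEN wL1_abs]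
        by (subst nn_integral_eq_integral[symmetric]) (auto simp: h_def weight_pos less_imp_le)
      also have "\<dots> = ennreal (\<bar>m\<bar> * wnorm \<alpha> (k g1 u) + \<bar>t\<bar> * wnorm \<alpha> (k g2 u))"
        using kw[THEN wL1_abs] by (simp add: wnorm_def)
      also have "\<dots> \<le> ennreal (\<bar>m\<bar> * \<epsilon> + \<bar>t\<bar> * \<epsilon>)"
        unfolding k_def by (intro ennreal_leI add_mono mult_left_mono near u) auto
      finally show ?thesis using True by (simp add: algebra_simps)
    qed (simp add: h_def)
  qed
  also have "\<dots> = ennreal ((\<bar>m\<bar> + \<bar>t\<bar>) * \<epsilon>)"
    by (simp add: nn_integral_cmult)
  finally show ?thesis
    using \<epsilon> by (simp add: e_def)
qed

text \<open>Writing \<open>r = l + e\<close> with the linear part \<open>l = - (m g1 + t g2)\<close>, the error of replacing \<open>r\<close> by \<open>l\<close>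
  in the quadratic expression consists of a mixed term and the square of \<open>e\<close>. Both are small compared
  with the square of the increment, since \<open>l\<close> is of first order and \<open>e\<close> of smaller order.\<close>

lemma kernel_form_tangent:
  assumes \<alpha>: "0 < \<alpha>" and q: "\<And>x. (q has_real_derivative q' x) (at x)"
    and q': "\<And>x. (q' has_real_derivative q'' x) (at x)"
  defines "g1 \<equiv> q'" and "g2 \<equiv> (\<lambda>x. q x + x * q' x)"
  assumes w: "wL1 \<alpha> q" "wL1 \<alpha> g1" "wL1 \<alpha> g2" and \<epsilon>: "0 < \<epsilon>"
  shows "\<exists>\<delta>>0. \<forall>m t r. \<bar>m\<bar> < \<delta> \<longrightarrow> \<bar>t\<bar> < \<delta> \<longrightarrow> r = (\<lambda>x. push m (1 + t) q x - q x) \<longrightarrow>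
    \<bar>kernel_form \<alpha> r r - (m\<^sup>2 * kernel_form \<alpha> g1 g1 + 2 * m * t * kernel_form \<alpha> g1 g2
        + t\<^sup>2 * kernel_form \<alpha> g2 g2)\<bar> \<le> \<epsilon> * (\<bar>m\<bar> + \<bar>t\<bar>)\<^sup>2"
proof -
  have \<alpha>0: "0 \<le> \<alpha>" using \<alpha> by simp
  have cont: "continuous_on UNIV q'" "continuous_on UNIV g1" "continuous_on UNIV g2"
    unfolding g1_def g2_def using DERIV_isCont[OF q] DERIV_isCont[OF q']
    by (auto simp: continuous_on_eq_continuous_at)
  define N where "N = wnorm \<alpha> g1 + wnorm \<alpha> g2"
  have N: "0 \<le> N" by (simp add: N_def wnorm_nonneg)
  \<comment> \<open>The error is at most \<open>2 powr \<alpha> * (2 * N * \<eta> + \<eta>\<^sup>2)\<close> times the square of the increment, and \<open>\<eta> \<le> 1\<close> bounds the square.\<close>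
  define \<eta> where "\<eta> = min 1 (\<epsilon> / (2 powr \<alpha> * (2 * N + 1)))"
  have \<eta>: "0 < \<eta>" "\<eta> \<le> 1" and \<eta>_le: "2 powr \<alpha> * (2 * N + 1) * \<eta> \<le> \<epsilon>"
    using \<epsilon> N by (auto simp: \<eta>_def min_def field_simps add_pos_nonneg zero_less_mult_iff)
  obtain \<delta>1 where \<delta>1: "0 < \<delta>1"
    "\<forall>m t. \<bar>m\<bar> < \<delta>1 \<longrightarrow> \<bar>t\<bar> < \<delta>1 \<longrightarrow> wnorm \<alpha> (\<lambda>x. push m (1 + t) g1 x / (1 + t) - g1 x) < \<eta>"
    using scaled_push_near[OF \<alpha> w(2) cont(2) \<eta>(1)] by blast
  obtain \<delta>2 where \<delta>2: "0 < \<delta>2"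
    "\<forall>m t. \<bar>m\<bar> < \<delta>2 \<longrightarrow> \<bar>t\<bar> < \<delta>2 \<longrightarrow> wnorm \<alpha> (\<lambda>x. push m (1 + t) g2 x / (1 + t) - g2 x) < \<eta>"
    using scaled_push_near[OF \<alpha> w(3) cont(3) \<eta>(1)] by blast
  show ?thesis
  proof (intro exI[of _ "min 1 (min \<delta>1 \<delta>2)"] conjI allI impI)
    show "0 < min 1 (min \<delta>1 \<delta>2)" using \<delta>1(1) \<delta>2(1) by simp
    fix m t r
    assume m: "\<bar>m\<bar> < min 1 (min \<delta>1 \<delta>2)" and t: "\<bar>t\<bar> < min 1 (min \<delta>1 \<delta>2)"
      and r: "r = (\<lambda>x. push m (1 + t) q x - q x)"
    define l where "l = (\<lambda>x. - m * g1 x + - t * g2 x)"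
    define e where "e = (\<lambda>x. push m (1 + t) q x - q x + (m * g1 x + t * g2 x))"
    have near: "wnorm \<alpha> (\<lambda>x. push (u * m) (1 + u * t) g x / (1 + u * t) - g x) \<le> \<eta>"
      if "0 \<le> u" "u \<le> 1" "g = g1 \<or> g = g2" for u g
    proof -
      have "\<bar>u * m\<bar> \<le> \<bar>m\<bar>" "\<bar>u * t\<bar> \<le> \<bar>t\<bar>"
        using that(1,2) by (auto simp: abs_mult intro!: mult_left_le_one_le)
      then show ?thesis
        using that(3) m t \<delta>1(2)[rule_format, of "u * m" "u * t"] \<delta>2(2)[rule_format, of "u * m" "u * t"]
        by (auto intro: less_imp_le)
    qed
    have e: "wnorm \<alpha> e \<le> (\<bar>m\<bar> + \<bar>t\<bar>) * \<eta>"
      unfolding e_def g1_def g2_def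
      by (rule wnorm_push_remainder_le[OF \<alpha>0 q cont(1)])
        (use t w near in \<open>auto simp: g1_def g2_def\<close>)
    have ew: "wL1 \<alpha> e"
      unfolding e_def using t by (intro wL1_add wL1_diff wL1_cmult wL1_push \<alpha>0 w) auto
    have lw: "wL1 \<alpha> l"
      unfolding l_def by (intro wL1_add wL1_cmult w)
    have "wnorm \<alpha> l \<le> \<bar>m\<bar> * wnorm \<alpha> g1 + \<bar>t\<bar> * wnorm \<alpha> g2"
      using wnorm_add_le[OF wL1_cmult[OF w(2), of "- m"] wL1_cmult[OF w(3), of "- t"]]
      by (simp only: l_def wnorm_cmult abs_minus_cancel)
    also have "\<dots> \<le> (\<bar>m\<bar> + \<bar>t\<bar>) * N"
      using mult_nonneg_nonneg[OF abs_ge_zero wnorm_nonneg, of m \<alpha> g2]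
        mult_nonneg_nonneg[OF abs_ge_zero wnorm_nonneg, of t \<alpha> g1]
      by (simp add: N_def algebra_simps)
    finally have l: "wnorm \<alpha> l \<le> (\<bar>m\<bar> + \<bar>t\<bar>) * N" .
    have "kernel_form \<alpha> l l = m\<^sup>2 * kernel_form \<alpha> g1 g1 + 2 * m * t * kernel_form \<alpha> g1 g2
        + t\<^sup>2 * kernel_form \<alpha> g2 g2"
      unfolding l_def
      by (simp only: kernel_form_add_left kernel_form_add_right \<alpha>0 wL1_cmult wL1_add w
          kernel_form_cmult_left kernel_form_cmult_right
          kernel_form_sym[OF wL1_measurable[OF w(3)] wL1_measurable[OF w(2)]])
        (simp add: power2_eq_square algebra_simps)
    moreover have "r = (\<lambda>x. l x + e x)"
      by (auto simp: r l_def e_def)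
    then have "kernel_form \<alpha> r r = kernel_form \<alpha> l l + (2 * kernel_form \<alpha> l e + kernel_form \<alpha> e e)"
      by (simp only: kernel_form_add_left kernel_form_add_right \<alpha>0 wL1_add ew lw
          kernel_form_sym[OF wL1_measurable[OF ew] wL1_measurable[OF lw]])
    moreover have "\<bar>2 * kernel_form \<alpha> l e + kernel_form \<alpha> e e\<bar> \<le> \<epsilon> * (\<bar>m\<bar> + \<bar>t\<bar>)\<^sup>2"
    proof -
      let ?h = "\<bar>m\<bar> + \<bar>t\<bar>"
      have "\<bar>kernel_form \<alpha> l e\<bar> \<le> 2 powr \<alpha> * ((?h * N) * (?h * \<eta>))"
        using kernel_form_bound[OF \<alpha>0 lw ew]
        by (rule order_trans) (intro mult_left_mono mult_mono l e, use N wnorm_nonneg in auto)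
      moreover have "\<bar>kernel_form \<alpha> e e\<bar> \<le> 2 powr \<alpha> * ((?h * 1) * (?h * \<eta>))"
        using kernel_form_bound[OF \<alpha>0 ew ew]
        by (rule order_trans) (intro mult_left_mono mult_mono e order_trans[OF e],
          use \<eta> wnorm_nonneg in auto)
      ultimately have "\<bar>2 * kernel_form \<alpha> l e + kernel_form \<alpha> e e\<bar>
          \<le> 2 * (2 powr \<alpha> * ((?h * N) * (?h * \<eta>))) + 2 powr \<alpha> * ((?h * 1) * (?h * \<eta>))"
        by linarith
      also have "\<dots> = (2 powr \<alpha> * (2 * N + 1) * \<eta>) * ?h\<^sup>2"
        by (simp add: power2_eq_square algebra_simps)
      also have "\<dots> \<le> \<epsilon> * ?h\<^sup>2"
        by (intro mult_right_mono \<eta>_le) auto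
      finally show ?thesis .
    qed
    ultimately show "\<bar>kernel_form \<alpha> r r - (m\<^sup>2 * kernel_form \<alpha> g1 g1 + 2 * m * t * kernel_form \<alpha> g1 g2
        + t\<^sup>2 * kernel_form \<alpha> g2 g2)\<bar> \<le> \<epsilon> * (\<bar>m\<bar> + \<bar>t\<bar>)\<^sup>2"
      by simp
  qed
qed

section \<open>The divergence of the kernel score\<close>

lemma location_scale_density:
  assumes q: "q \<in> borel_measurable borel" and prob: "prob_space (density lborel (\<lambda>x. ennreal (q x)))"
    and s: "0 < \<theta> $ 2" and nonneg: "\<And>x. 0 \<le> q x"
  shows "location_scale \<theta> (density lborel (\<lambda>x. ennreal (q x)))
    = density lborel (\<lambda>x. ennreal (push (\<theta> $ 1) (\<theta> $ 2) q x))"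
proof -
  note [measurable] = q
  interpret prob_space "density lborel (\<lambda>x. ennreal (q x))" by fact
  have "distributed (density lborel (\<lambda>x. ennreal (q x))) lborel (\<lambda>x. x) (\<lambda>x. ennreal (q x))"
    by (auto simp: distributed_def distr_id2)
  from distributed_affine[OF this, of "\<theta> $ 2" "\<theta> $ 1"] s
  have "distr (density lborel (\<lambda>x. ennreal (q x))) lborel (\<lambda>x. \<theta> $ 1 + \<theta> $ 2 * x)
      = density lborel (\<lambda>x. ennreal (q ((x - \<theta> $ 1) / \<theta> $ 2)) / ennreal \<bar>\<theta> $ 2\<bar>)"
    by (simp add: distributed_def)
  then show ?thesis
    using s nonneg by (simp add: location_scale_def push_def divide_ennreal cong: distr_cong)
qed

lemma expected_kernel_score_density:
  assumes \<alpha>: "0 \<le> \<alpha>" and p: "wL1 \<alpha> p" "\<And>x. 0 \<le> p x" and p': "wL1 \<alpha> p'" "\<And>x. 0 \<le> p' x"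
    and prob: "prob_space (density lborel (\<lambda>x. ennreal (p x)))" "prob_space (density lborel (\<lambda>x. ennreal (p' x)))"
  shows "expected_score (kernel_score \<alpha>) (density lborel (\<lambda>x. ennreal (p x))) (density lborel (\<lambda>x. ennreal (p' x)))
    = 1 / 2 * kernel_form \<alpha> p p - kernel_form \<alpha> p p'"
proof -
  have [measurable]: "p \<in> borel_measurable borel" "p' \<in> borel_measurable borel"
    using p(1) p'(1) by (auto dest: wL1_measurable)
  let ?P = "density lborel (\<lambda>x. ennreal (p x))" and ?P' = "density lborel (\<lambda>x. ennreal (p' x))"
  interpret P: prob_space ?P by fact
  interpret P': prob_space ?P' by fact
  have PP: "(\<integral>(x, x'). \<bar>x - x'\<bar> powr \<alpha> \<partial>(?P \<Otimes>\<^sub>M ?P)) = kernel_form \<alpha> p p"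
  proof -
    have "?P \<Otimes>\<^sub>M ?P = density (lborel \<Otimes>\<^sub>M lborel) (\<lambda>(x, y). ennreal (p x) * ennreal (p y))"
      by (rule pair_measure_density) (auto intro: lborel.sigma_finite_measure_axioms P.sigma_finite_measure_axioms)
    also have "\<dots> = density (lborel \<Otimes>\<^sub>M lborel) (\<lambda>z. ennreal (p (fst z) * p (snd z)))"
      using p(2) by (simp add: split_beta' ennreal_mult)
    finally show ?thesis
      using p(2) by (simp add: integral_density kernel_form_def split_beta' ac_simps)
  qed
  let ?g = "\<lambda>y. \<integral>x. \<bar>x - y\<bar> powr \<alpha> * p x * p' y \<partial>lborel"
  have int: "integrable (lborel \<Otimes>\<^sub>M lborel) (\<lambda>(x, y). \<bar>x - y\<bar> powr \<alpha> * p x * p' y)"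
    using kernel_form_integrable[OF \<alpha> p(1) p'(1)] by (simp add: split_beta')
  have g: "(\<integral>x. \<bar>x - y\<bar> powr \<alpha> \<partial>?P) * p' y = ?g y" for y
  proof -
    have "(\<integral>x. \<bar>x - y\<bar> powr \<alpha> \<partial>?P) = (\<integral>x. p x * \<bar>x - y\<bar> powr \<alpha> \<partial>lborel)"
      using p(2) by (subst integral_density) auto
    then have "(\<integral>x. \<bar>x - y\<bar> powr \<alpha> \<partial>?P) * p' y = (\<integral>x. p x * \<bar>x - y\<bar> powr \<alpha> * p' y \<partial>lborel)"
      by simp
    then show ?thesis by (simp only: mult.commute[of "p _"])
  qed
  have gi: "integrable ?P' (\<lambda>y. \<integral>x. \<bar>x - y\<bar> powr \<alpha> \<partial>?P)"
  proof (subst integrable_density)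
    show "integrable lborel (\<lambda>y. p' y *\<^sub>R (\<integral>x. \<bar>x - y\<bar> powr \<alpha> \<partial>?P))"
      using lborel_pair.integrable_snd[OF int] by (simp only: g[symmetric]) (simp only: real_scaleR_def mult.commute)
  qed (use p' in auto)
  have "(\<integral>y. (\<integral>x. \<bar>x - y\<bar> powr \<alpha> \<partial>?P) \<partial>?P') = (\<integral>y. p' y *\<^sub>R (\<integral>x. \<bar>x - y\<bar> powr \<alpha> \<partial>?P) \<partial>lborel)"
    using p' by (intro integral_density) auto
  also have "\<dots> = (\<integral>y. ?g y \<partial>lborel)"
    by (simp only: g[symmetric]) (simp only: real_scaleR_def mult.commute)
  also have "\<dots> = kernel_form \<alpha> p p'"
    using lborel_pair.integral_snd[OF int] by (simp add: kernel_form_def split_beta')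
  finally have "(\<integral>y. (\<integral>x. \<bar>x - y\<bar> powr \<alpha> \<partial>?P) \<partial>?P') = kernel_form \<alpha> p p'" .
  then show ?thesis
    unfolding expected_score_def kernel_score_def PP
    using gi P'.prob_space by (simp add: Bochner_Integration.integral_diff)
qed

text \<open>The terms of the two expected scores combine into the square of the difference of the densities.
  That difference is the transform by \<open>\<theta>\<close> of an increment of the base density, because moving \<open>\<theta>\<close> to
  \<open>\<theta> + d\<close> amounts to moving \<open>(0, 1)\<close> to \<open>(d1 / \<sigma>, 1 + d2 / \<sigma>)\<close> beforehand.\<close>

lemma kernel_divergence_eq:
  assumes \<alpha>: "0 \<le> \<alpha>" and q: "wL1 \<alpha> q" "\<And>x. 0 \<le> q x" "prob_space (density lborel (\<lambda>x. ennreal (q x)))"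
    and s: "0 < \<theta> $ 2" "0 < (\<theta> + d) $ 2"
  defines "Q \<equiv> density lborel (\<lambda>x. ennreal (q x))"
    and "r \<equiv> (\<lambda>x. push (d $ 1 / \<theta> $ 2) (1 + d $ 2 / \<theta> $ 2) q x - q x)"
  shows "expected_score (kernel_score \<alpha>) (location_scale \<theta> Q) (location_scale \<theta> Q)
      - expected_score (kernel_score \<alpha>) (location_scale (\<theta> + d) Q) (location_scale \<theta> Q)
    = - 1 / 2 * (\<theta> $ 2) powr \<alpha> * kernel_form \<alpha> r r"
proof -
  note qm = wL1_measurable[OF q(1)]
  interpret prob_space Q unfolding Q_def by fact
  have qpair: "location_scale \<theta>' Q = density lborel (\<lambda>x. ennreal (push (\<theta>' $ 1) (\<theta>' $ 2) q x))"
      "wL1 \<alpha> (push (\<theta>' $ 1) (\<theta>' $ 2) q)" "\<And>x. 0 \<le> push (\<theta>' $ 1) (\<theta>' $ 2) q x"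
      "prob_space (density lborel (\<lambda>x. ennreal (push (\<theta>' $ 1) (\<theta>' $ 2) q x)))"
    if "0 < \<theta>' $ 2" for \<theta>'
  proof -
    show 1: "location_scale \<theta>' Q = density lborel (\<lambda>x. ennreal (push (\<theta>' $ 1) (\<theta>' $ 2) q x))"
      unfolding Q_def by (intro location_scale_density qm q that)
    show "wL1 \<alpha> (push (\<theta>' $ 1) (\<theta>' $ 2) q)" by (intro wL1_push \<alpha> q that)
    show "0 \<le> push (\<theta>' $ 1) (\<theta>' $ 2) q x" for x using q(2) that by (simp add: push_def)
    show "prob_space (density lborel (\<lambda>x. ennreal (push (\<theta>' $ 1) (\<theta>' $ 2) q x)))"
      unfolding 1[symmetric] location_scale_def by (rule prob_space_distr) (simp add: Q_def)
  qed
  note P = qpair[OF s(1)] and P' = qpair[OF s(2)]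
  define p where "p = push (\<theta> $ 1) (\<theta> $ 2) q"
  define p' where "p' = push ((\<theta> + d) $ 1) ((\<theta> + d) $ 2) q"
  note P = P[folded p_def] and P' = P'[folded p'_def]
  have rw: "wL1 \<alpha> r"
    unfolding r_def using s by (intro wL1_diff wL1_push \<alpha> q) (simp add: field_simps)
  have pr: "p' = (\<lambda>x. p x + push (\<theta> $ 1) (\<theta> $ 2) r x)"
  proof
    fix x
    have arg: "(x - (\<theta> + d) $ 1) / (\<theta> + d) $ 2
        = ((x - \<theta> $ 1) / \<theta> $ 2 - d $ 1 / \<theta> $ 2) / (1 + d $ 2 / \<theta> $ 2)"
    proof -
      have "1 + d $ 2 / \<theta> $ 2 = (\<theta> + d) $ 2 / \<theta> $ 2"
        "(x - \<theta> $ 1) / \<theta> $ 2 - d $ 1 / \<theta> $ 2 = (x - (\<theta> + d) $ 1) / \<theta> $ 2"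
        using s by (simp_all add: field_simps)
      then show ?thesis using s by simp
    qed
    have scale: "(\<theta> + d) $ 2 = (1 + d $ 2 / \<theta> $ 2) * \<theta> $ 2"
      using s by (simp add: field_simps)
    show "p' x = p x + push (\<theta> $ 1) (\<theta> $ 2) r x"
      unfolding p'_def p_def push_def r_def arg
      by (simp only: scale) (simp add: diff_divide_distrib)
  qed
  have "expected_score (kernel_score \<alpha>) (location_scale \<theta> Q) (location_scale \<theta> Q)
      - expected_score (kernel_score \<alpha>) (location_scale (\<theta> + d) Q) (location_scale \<theta> Q)
    = - 1 / 2 * kernel_form \<alpha> p p - (1 / 2 * kernel_form \<alpha> p' p' - kernel_form \<alpha> p' p)"
    unfolding P(1) P'(1)
    by (simp add: expected_kernel_score_density \<alpha> P(2-4) P'(2-4))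
  also have "\<dots> = - 1 / 2 * kernel_form \<alpha> (push (\<theta> $ 1) (\<theta> $ 2) r) (push (\<theta> $ 1) (\<theta> $ 2) r)"
  proof -
    let ?R = "push (\<theta> $ 1) (\<theta> $ 2) r"
    have Rw: "wL1 \<alpha> ?R" by (intro wL1_push \<alpha> rw s)
    show ?thesis
      unfolding pr
      by (simp only: kernel_form_add_left kernel_form_add_right \<alpha> wL1_add P(2) Rw
          kernel_form_sym[OF wL1_measurable[OF Rw] wL1_measurable[OF P(2)]]) (simp add: field_simps)
  qed
  also have "\<dots> = - 1 / 2 * (\<theta> $ 2) powr \<alpha> * kernel_form \<alpha> r r"
    by (simp add: kernel_form_push \<alpha> rw s)
  finally show ?thesis .
qed

section \<open>The scale matrix\<close>

text \<open>Up to sign, the logarithmic derivatives at \<open>(0, 1)\<close> of the location-scale density with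
  respect to the location (\<open>i = 1\<close>) and the scale (\<open>i = 2\<close>), when \<open>\<psi>\<close> is the derivative of the log-density.\<close>

definition gradient_factor :: "(real \<Rightarrow> real) \<Rightarrow> 2 \<Rightarrow> real \<Rightarrow> real" where
  "gradient_factor \<psi> i x = (if i = 1 then \<psi> x else 1 + x * \<psi> x)"

definition kernel_score_H :: "real \<Rightarrow> (real \<Rightarrow> real) \<Rightarrow> real \<times> real \<Rightarrow> real ^ 2 ^ 2" where
  "kernel_score_H \<alpha> \<psi> z = (\<chi> i j. - 1 / 2 * \<bar>fst z - snd z\<bar> powr \<alpha>
     * gradient_factor \<psi> i (fst z) * gradient_factor \<psi> j (snd z))"

lemma integrable_matrix:
  fixes H :: "'a \<Rightarrow> real ^ 'n ^ 'm"
  assumes "\<And>i j. integrable M (\<lambda>z. H z $ i $ j)"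
  shows "integrable M H" and "(\<integral>z. H z \<partial>M) $ i $ j = (\<integral>z. H z $ i $ j \<partial>M)"
proof -
  have basis: "b \<in> Basis \<Longrightarrow> \<exists>i j. \<forall>A :: real ^ 'n ^ 'm. A \<bullet> b = A $ i $ j" for b :: "real ^ 'n ^ 'm"
    unfolding Basis_vec_def by (force simp: inner_axis)
  have "integrable M (\<lambda>z. \<Sum>b\<in>Basis. (H z \<bullet> b) *\<^sub>R b)"
  proof (intro Bochner_Integration.integrable_sum integrable_scaleR_left)
    fix b :: "real ^ 'n ^ 'm" assume "b \<in> Basis"
    with basis obtain i j where "\<And>A :: real ^ 'n ^ 'm. A \<bullet> b = A $ i $ j" by blast
    then show "integrable M (\<lambda>z. H z \<bullet> b)" using assms by simp
  qed
  then show H: "integrable M H" by (simp add: euclidean_representation)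
  have "bounded_linear (\<lambda>A :: real ^ 'n ^ 'm. A $ i $ j)"
    by (intro bounded_linear_compose[OF bounded_linear_vec_nth bounded_linear_vec_nth])
  from integral_bounded_linear[OF this H]
  show "(\<integral>z. H z \<partial>M) $ i $ j = (\<integral>z. H z $ i $ j \<partial>M)" by simp
qed

lemma quadratic_form_2:
  fixes M :: "real ^ 2 ^ 2"
  shows "v \<bullet> (M *v v) = v $ 1 * (M $ 1 $ 1 * v $ 1 + M $ 1 $ 2 * v $ 2)
    + v $ 2 * (M $ 2 $ 1 * v $ 1 + M $ 2 $ 2 * v $ 2)"
  by (simp add: inner_vec_def sum_2 matrix_vector_mult_def)

text \<open>A quadratic form that is \<open>o((norm d)\<^sup>2)\<close> vanishes by homogeneity: its value at \<open>v\<close> is read off at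
  arbitrarily short multiples of \<open>v\<close>. Symmetry then recovers the entries from the form.\<close>

lemma symmetric_form_unique:
  fixes A B :: "real ^ 2 ^ 2"
  assumes sym: "transpose A = A" "transpose B = B"
    and A: "(\<lambda>d. D d - d \<bullet> (A *v d)) \<in> o[at 0](\<lambda>d. (norm d)\<^sup>2)"
    and B: "(\<lambda>d. D d - d \<bullet> (B *v d)) \<in> o[at 0](\<lambda>d. (norm d)\<^sup>2)"
  shows "A = B"
proof -
  define M where "M = A - B"
  have "(\<lambda>d. (D d - d \<bullet> (B *v d)) - (D d - d \<bullet> (A *v d))) \<in> o[at 0](\<lambda>d. (norm d)\<^sup>2)"
    by (rule sum_in_smallo(2)[OF B A])
  moreover have "(D d - d \<bullet> (B *v d)) - (D d - d \<bullet> (A *v d)) = d \<bullet> (M *v d)" for d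
    by (simp add: M_def matrix_vector_mult_diff_rdistrib inner_diff_right)
  ultimately have small: "(\<lambda>d. d \<bullet> (M *v d)) \<in> o[at 0](\<lambda>d. (norm d)\<^sup>2)"
    by simp
  have zero: "v \<bullet> (M *v v) = 0" for v
  proof (cases "v = 0")
    case False
    have "\<bar>v \<bullet> (M *v v)\<bar> \<le> \<epsilon>" if "0 < \<epsilon>" for \<epsilon>
    proof -
      define c where "c = \<epsilon> / (norm v)\<^sup>2"
      have c: "0 < c" using that False by (simp add: c_def)
      from landau_o.smallD[OF small c]
      obtain \<delta> where \<delta>: "0 < \<delta>" "\<And>d. d \<noteq> 0 \<Longrightarrow> norm d < \<delta> \<Longrightarrow> \<bar>d \<bullet> (M *v d)\<bar> \<le> c * (norm d)\<^sup>2"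
        unfolding eventually_at dist_norm by (auto simp: norm_power)
      define k where "k = \<delta> / (2 * norm v)"
      have k: "0 < k" using \<delta> False by (simp add: k_def)
      have "\<bar>(k *\<^sub>R v) \<bullet> (M *v (k *\<^sub>R v))\<bar> \<le> c * (norm (k *\<^sub>R v))\<^sup>2"
        using \<delta>(1) False k by (intro \<delta>(2)) (auto simp: k_def)
      moreover have "(k *\<^sub>R v) \<bullet> (M *v (k *\<^sub>R v)) = k\<^sup>2 * (v \<bullet> (M *v v))"
        by (simp add: matrix_vector_mult_scaleR power2_eq_square)
      moreover have "c * (norm (k *\<^sub>R v))\<^sup>2 = k\<^sup>2 * (c * (norm v)\<^sup>2)"
        by (simp add: power_mult_distrib)
      ultimately have "k\<^sup>2 * \<bar>v \<bullet> (M *v v)\<bar> \<le> k\<^sup>2 * (c * (norm v)\<^sup>2)"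
        by (simp only: abs_mult abs_power2)
      then have "\<bar>v \<bullet> (M *v v)\<bar> \<le> c * (norm v)\<^sup>2"
        using k by simp
      then show ?thesis using False by (simp add: c_def)
    qed
    then have "\<bar>v \<bullet> (M *v v)\<bar> \<le> 0" by (rule field_le_epsilon) simp
    then show ?thesis by simp
  qed simp
  have diag: "M $ 1 $ 1 = 0" "M $ 2 $ 2 = 0"
    using zero[of "vector [1, 0]"] zero[of "vector [0, 1]"] by (simp_all add: quadratic_form_2)
  have "A $ 1 $ 2 = A $ 2 $ 1" "B $ 1 $ 2 = B $ 2 $ 1"
    using sym[THEN arg_cong, of "\<lambda>M. M $ 2 $ 1"] by (simp_all add: transpose_def)
  then have "M $ 1 $ 2 = M $ 2 $ 1" by (simp add: M_def)
  moreover have "M $ 1 $ 2 + M $ 2 $ 1 = 0"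
    using zero[of "vector [1, 1]"] diag by (simp add: quadratic_form_2)
  ultimately have "M $ 1 $ 2 = 0" "M $ 2 $ 1 = 0" by linarith+
  then show ?thesis
    using diag by (simp add: M_def vec_eq_iff forall_2)
qed

text \<open>The requirement that a scale function meets at a single parameter.\<close>

definition scale_matrix :: "scoring_rule \<Rightarrow> real measure \<Rightarrow> real ^ 2 \<Rightarrow> real ^ 2 ^ 2 \<Rightarrow> bool" where
  "scale_matrix S Q \<theta> M \<longleftrightarrow> transpose M = M \<and>
     (\<lambda>d. expected_score S (location_scale \<theta> Q) (location_scale \<theta> Q)
          - expected_score S (location_scale (\<theta> + d) Q) (location_scale \<theta> Q)
          - d \<bullet> (M *v d)) \<in> o[at 0](\<lambda>d. (norm d)\<^sup>2)"

lemma is_scale_function_iff: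
  "is_scale_function S Q0 s \<longleftrightarrow> (\<forall>Q\<in>Q0. \<forall>\<theta>. 0 < \<theta> $ 2 \<longrightarrow> scale_matrix S Q \<theta> (s Q \<theta>))"
  by (simp only: is_scale_function_def scale_matrix_def)

lemma scale_matrix_unique: "scale_matrix S Q \<theta> M \<Longrightarrow> scale_matrix S Q \<theta> N \<Longrightarrow> M = N"
  unfolding scale_matrix_def by (elim conjE) (rule symmetric_form_unique)

text \<open>Interpolates between the moments of order zero and order \<open>\<gamma>\<close>.\<close>

lemma powr_le_one_plus_powr:
  fixes x \<beta> \<gamma> :: real
  assumes "0 \<le> \<beta>" "\<beta> \<le> \<gamma>"
  shows "\<bar>x\<bar> powr \<beta> \<le> 1 + \<bar>x\<bar> powr \<gamma>"
proof (cases "\<bar>x\<bar> \<le> 1")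
  case True
  then have "\<bar>x\<bar> powr \<beta> \<le> 1 powr \<beta>" using assms by (intro powr_mono2) auto
  then show ?thesis by (simp add: add_increasing2)
next
  case False
  then have "\<bar>x\<bar> powr \<beta> \<le> \<bar>x\<bar> powr \<gamma>" using assms by (intro powr_mono) auto
  then show ?thesis by simp
qed

text \<open>The multipliers of \<open>\<Psi>'\<close> that occur in the weighted norms of the parameter derivatives are
  dominated by a constant plus the power \<open>\<alpha> + 1\<close>, for which the moments are finite by hypothesis.\<close>

lemma
  assumes "0 \<le> \<alpha>"
  shows weight_le_powr: "weight \<alpha> x \<le> 2 * (1 + \<bar>x\<bar> powr (\<alpha> + 1))"
    and weight_mult_le_powr: "\<bar>weight \<alpha> x * x\<bar> \<le> 2 * (1 + \<bar>x\<bar> powr (\<alpha> + 1))"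
proof -
  define a b r where "a = \<bar>x\<bar> powr \<alpha>" and "b = \<bar>x\<bar> powr 1" and "r = \<bar>x\<bar> powr (\<alpha> + 1)"
  have le: "a \<le> 1 + r" "b \<le> 1 + r" "0 \<le> r"
    using assms unfolding a_def b_def r_def by (intro powr_le_one_plus_powr powr_ge_zero; simp)+
  have "1 + a \<le> 2 * (1 + r)" using le by argo
  then show "weight \<alpha> x \<le> 2 * (1 + \<bar>x\<bar> powr (\<alpha> + 1))"
    by (simp only: weight_def a_def r_def)
  have "\<bar>weight \<alpha> x * x\<bar> = b + r"
    unfolding abs_mult abs_of_pos[OF weight_pos]
    by (simp add: weight_def powr_add algebra_simps b_def r_def)
  moreover have "b + r \<le> 2 * (1 + r)" using le by argo
  ultimately show "\<bar>weight \<alpha> x * x\<bar> \<le> 2 * (1 + \<bar>x\<bar> powr (\<alpha> + 1))"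
    by (simp only: r_def)
qed

text \<open>Extracts from the moment conditions what the expansion uses: \<open>q\<close> is the density \<open>exp \<Psi>\<close>, \<open>\<psi>\<close> is
  \<open>\<Psi>'\<close>, and the last two functions are the parameter derivatives of the density up to sign.\<close>

lemma assumption_A_weighted_density:
  assumes \<alpha>: "0 < \<alpha>" and A: "assumption_A \<alpha> Q"
  obtains q q' q'' \<psi> where
    "Q = density lborel (\<lambda>x. ennreal (q x))" "\<And>x. 0 \<le> q x"
    "\<And>x. (q has_real_derivative q' x) (at x)" "\<And>x. (q' has_real_derivative q'' x) (at x)"
    "\<And>x. q' x = \<psi> x * q x" "\<psi> \<in> borel_measurable borel"
    "wL1 \<alpha> q" "wL1 \<alpha> q'" "wL1 \<alpha> (\<lambda>x. q x + x * q' x)"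
proof -
  from A obtain \<Psi> \<Psi>' \<Psi>'' where prob: "prob_space Q"
    and d: "\<And>x. (\<Psi> has_real_derivative \<Psi>' x) (at x)" "\<And>x. (\<Psi>' has_real_derivative \<Psi>'' x) (at x)"
    and Q: "Q = density lborel (\<lambda>x. ennreal (exp (\<Psi> x)))"
    and int: "integrable Q \<Psi>'" "integrable Q (\<lambda>x. \<bar>x\<bar> powr \<alpha>)"
      "integrable Q (\<lambda>x. \<bar>x\<bar> powr (\<alpha> + 1) * \<Psi>' x)"
    unfolding assumption_A_def by blast
  interpret prob_space Q by fact
  have [measurable]: "\<Psi> \<in> borel_measurable borel" "\<Psi>' \<in> borel_measurable borel"
    using d[THEN DERIV_isCont] by (auto intro!: borel_measurable_continuous_onI simp: continuous_on_eq_continuous_at)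
  let ?q = "\<lambda>x. exp (\<Psi> x)" and ?q' = "\<lambda>x. \<Psi>' x * exp (\<Psi> x)"
  have dens: "integrable Q f \<longleftrightarrow> integrable lborel (\<lambda>x. exp (\<Psi> x) * f x)"
    if "f \<in> borel_measurable borel" for f :: "real \<Rightarrow> real"
    unfolding Q using that by (subst integrable_density) auto
  have Qborel: "f \<in> borel_measurable Q" if "f \<in> borel_measurable borel" for f :: "real \<Rightarrow> real"
    using that by (simp add: Q)
  have dom: "integrable Q (\<lambda>x. c x * \<Psi>' x)"
    if [measurable]: "c \<in> borel_measurable borel"
      and c: "\<And>x. \<bar>c x\<bar> \<le> 2 * (1 + \<bar>x\<bar> powr (\<alpha> + 1))" for c
  proof (rule Bochner_Integration.integrable_bound)
    show "integrable Q (\<lambda>x. 2 * (\<bar>\<Psi>' x\<bar> + \<bar>\<bar>x\<bar> powr (\<alpha> + 1) * \<Psi>' x\<bar>))"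
      using int by (intro integrable_mult_right Bochner_Integration.integrable_add integrable_abs) auto
    show "(\<lambda>x. c x * \<Psi>' x) \<in> borel_measurable Q" by (intro Qborel) measurable
    show "AE x in Q. norm (c x * \<Psi>' x) \<le> norm (2 * (\<bar>\<Psi>' x\<bar> + \<bar>\<bar>x\<bar> powr (\<alpha> + 1) * \<Psi>' x\<bar>))"
    proof (rule AE_I2)
      fix x
      have "\<bar>c x\<bar> * \<bar>\<Psi>' x\<bar> \<le> 2 * (1 + \<bar>x\<bar> powr (\<alpha> + 1)) * \<bar>\<Psi>' x\<bar>"
        by (intro mult_right_mono c) auto
      then show "norm (c x * \<Psi>' x) \<le> norm (2 * (\<bar>\<Psi>' x\<bar> + \<bar>\<bar>x\<bar> powr (\<alpha> + 1) * \<Psi>' x\<bar>))"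
        by (simp add: abs_mult algebra_simps)
    qed
  qed
  have wq: "integrable Q (weight \<alpha>)"
    unfolding weight_def using int by simp
  have wg1: "integrable Q (\<lambda>x. weight \<alpha> x * \<Psi>' x)"
    by (intro dom) (simp_all only: abs_of_pos[OF weight_pos] weight_le_powr[OF less_imp_le[OF \<alpha>]] weight_measurable)
  have wg2: "integrable Q (\<lambda>x. weight \<alpha> x + weight \<alpha> x * x * \<Psi>' x)"
    by (intro Bochner_Integration.integrable_add wq dom weight_mult_le_powr) (use \<alpha> in auto)
  show thesis
  proof (rule that[of ?q ?q' "\<lambda>x. \<Psi>'' x * exp (\<Psi> x) + \<Psi>' x * (\<Psi>' x * exp (\<Psi> x))" \<Psi>'])
    show "Q = density lborel (\<lambda>x. ennreal (exp (\<Psi> x)))" by (fact Q)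
    show "(?q has_real_derivative ?q' x) (at x)" for x
      by (auto intro!: derivative_eq_intros d)
    show "(?q' has_real_derivative \<Psi>'' x * exp (\<Psi> x) + \<Psi>' x * (\<Psi>' x * exp (\<Psi> x))) (at x)" for x
      by (auto intro!: derivative_eq_intros d)
    show "wL1 \<alpha> ?q" using wq by (simp add: wL1_def dens mult.commute)
    show "wL1 \<alpha> ?q'" using wg1 by (simp add: wL1_def dens ac_simps)
    show "wL1 \<alpha> (\<lambda>x. ?q x + x * ?q' x)" using wg2 by (simp add: wL1_def dens algebra_simps)
  qed auto
qed

text \<open>Expansion at every parameter for one base measure, with a matrix that varies with the parameter
  only through the power of the scale.\<close>

lemma kernel_score_expansion:
  assumes \<alpha>: "0 < \<alpha>" and A: "assumption_A \<alpha> Q"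
  shows "\<exists>\<psi>. integrable (Q \<Otimes>\<^sub>M Q) (kernel_score_H \<alpha> \<psi>) \<and>
    (\<forall>\<theta>. 0 < \<theta> $ 2 \<longrightarrow> scale_matrix (kernel_score \<alpha>) Q \<theta>
      ((\<theta> $ 2) powr (\<alpha> - 2) *\<^sub>R (\<integral>z. kernel_score_H \<alpha> \<psi> z \<partial>(Q \<Otimes>\<^sub>M Q))))"
proof -
  from A have prob: "prob_space Q" by (simp add: assumption_A_def)
  from \<alpha> have \<alpha>0: "0 \<le> \<alpha>" by simp
  obtain q q' q'' \<psi> where Q: "Q = density lborel (\<lambda>x. ennreal (q x))" and nonneg: "\<And>x. 0 \<le> q x"
    and q: "\<And>x. (q has_real_derivative q' x) (at x)" and q': "\<And>x. (q' has_real_derivative q'' x) (at x)"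
    and \<psi>: "\<And>x. q' x = \<psi> x * q x" and [measurable]: "\<psi> \<in> borel_measurable borel"
    and w: "wL1 \<alpha> q" "wL1 \<alpha> q'" "wL1 \<alpha> (\<lambda>x. q x + x * q' x)"
    by (rule assumption_A_weighted_density[OF \<alpha> A]) (rule that; assumption)
  define g where "g = (\<lambda>(i::2) x. if i = 1 then q' x else q x + x * q' x)"
  have g: "g 1 = q'" "g 2 = (\<lambda>x. q x + x * q' x)" by (auto simp: g_def fun_eq_iff)
  have gw: "wL1 \<alpha> (g i)" for i
    using w(2,3) exhaust_2[of i] g by metis
  have gf: "gradient_factor \<psi> i x * q x = g i x" for i x
    by (simp add: gradient_factor_def g_def \<psi> algebra_simps)
  have [measurable]: "q \<in> borel_measurable borel" "gradient_factor \<psi> i \<in> borel_measurable borel" for i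
    using wL1_measurable[OF w(1)] unfolding gradient_factor_def by measurable
  interpret Q: prob_space Q by fact
  have QQ: "Q \<Otimes>\<^sub>M Q = density (lborel \<Otimes>\<^sub>M lborel) (\<lambda>z. ennreal (q (fst z) * q (snd z)))"
    unfolding Q using Q.sigma_finite_measure_axioms nonneg
    by (subst pair_measure_density)
      (auto simp: Q split_beta' ennreal_mult intro: lborel.sigma_finite_measure_axioms)
  have H_entry: "q (fst z) * q (snd z) * kernel_score_H \<alpha> \<psi> z $ i $ j
      = - 1 / 2 * (\<bar>fst z - snd z\<bar> powr \<alpha> * g i (fst z) * g j (snd z))" for z i j
    by (simp add: kernel_score_H_def gf[symmetric] ac_simps)
  have H_meas: "(\<lambda>z. kernel_score_H \<alpha> \<psi> z $ i $ j) \<in> borel_measurable (lborel \<Otimes>\<^sub>M lborel)" for i j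
    by (simp add: kernel_score_H_def)
  have H_int: "integrable (Q \<Otimes>\<^sub>M Q) (\<lambda>z. kernel_score_H \<alpha> \<psi> z $ i $ j)" for i j
    unfolding QQ
    by (subst integrable_density)
      (use H_meas nonneg kernel_form_integrable[OF \<alpha>0 gw gw] in \<open>auto simp: H_entry\<close>)
  have H: "integrable (Q \<Otimes>\<^sub>M Q) (kernel_score_H \<alpha> \<psi>)"
    by (rule integrable_matrix(1)[OF H_int])
  define M where "M = (\<integral>z. kernel_score_H \<alpha> \<psi> z \<partial>(Q \<Otimes>\<^sub>M Q))"
  have M: "M $ i $ j = - 1 / 2 * kernel_form \<alpha> (g i) (g j)" for i j
  proof -
    have "M $ i $ j = (\<integral>z. kernel_score_H \<alpha> \<psi> z $ i $ j \<partial>(Q \<Otimes>\<^sub>M Q))"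
      unfolding M_def by (rule integrable_matrix(2)[OF H_int])
    also have "\<dots> = (\<integral>z. q (fst z) * q (snd z) * kernel_score_H \<alpha> \<psi> z $ i $ j \<partial>(lborel \<Otimes>\<^sub>M lborel))"
      unfolding QQ using H_meas nonneg by (subst integral_density) auto
    also have "\<dots> = - 1 / 2 * kernel_form \<alpha> (g i) (g j)"
      unfolding H_entry kernel_form_def by (rule integral_mult_right_zero)
    finally show ?thesis .
  qed
  have M_sym: "transpose M = M"
    using gw[THEN wL1_measurable]
    by (auto simp: vec_eq_iff transpose_def M intro: kernel_form_sym)
  have "scale_matrix (kernel_score \<alpha>) Q \<theta> ((\<theta> $ 2) powr (\<alpha> - 2) *\<^sub>R M)" if \<theta>: "0 < \<theta> $ 2" for \<theta>
    unfolding scale_matrix_def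
  proof (intro conjI)
    let ?\<sigma> = "\<theta> $ 2"
    show "transpose (?\<sigma> powr (\<alpha> - 2) *\<^sub>R M) = ?\<sigma> powr (\<alpha> - 2) *\<^sub>R M"
      using M_sym by (simp add: transpose_def vec_eq_iff)
    let ?D = "\<lambda>d. expected_score (kernel_score \<alpha>) (location_scale \<theta> Q) (location_scale \<theta> Q)
             - expected_score (kernel_score \<alpha>) (location_scale (\<theta> + d) Q) (location_scale \<theta> Q)"
    show "(\<lambda>d. ?D d - d \<bullet> ((?\<sigma> powr (\<alpha> - 2) *\<^sub>R M) *v d)) \<in> o[at 0](\<lambda>d. (norm d)\<^sup>2)"
    proof (rule landau_o.smallI)
      fix c :: real assume c: "0 < c"
      \<comment> \<open>The factor \<open>1 / 2\<close> of the divergence and the bound \<open>\<bar>d $ 1\<bar> + \<bar>d $ 2\<bar> \<le> 2 * norm d\<close> together cost a factor 2.\<close>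
      define \<epsilon> where "\<epsilon> = c / (2 * ?\<sigma> powr (\<alpha> - 2))"
      have \<epsilon>: "0 < \<epsilon>" using c \<theta> by (simp add: \<epsilon>_def)
      obtain \<delta> where \<delta>: "0 < \<delta>" and near: "\<And>m t r. \<bar>m\<bar> < \<delta> \<Longrightarrow> \<bar>t\<bar> < \<delta> \<Longrightarrow>
          r = (\<lambda>x. push m (1 + t) q x - q x) \<Longrightarrow>
          \<bar>kernel_form \<alpha> r r - (m\<^sup>2 * kernel_form \<alpha> (g 1) (g 1) + 2 * m * t * kernel_form \<alpha> (g 1) (g 2)
            + t\<^sup>2 * kernel_form \<alpha> (g 2) (g 2))\<bar> \<le> \<epsilon> * (\<bar>m\<bar> + \<bar>t\<bar>)\<^sup>2"
        using kernel_form_tangent[OF \<alpha> q q' w \<epsilon>] unfolding g by blast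
      have "norm (?D d - d \<bullet> ((?\<sigma> powr (\<alpha> - 2) *\<^sub>R M) *v d)) \<le> c * norm ((norm d)\<^sup>2)"
        if d: "norm d < min 1 \<delta> * ?\<sigma>" for d
      proof -
        let ?m = "d $ 1 / ?\<sigma>" and ?t = "d $ 2 / ?\<sigma>"
        have small: "\<bar>d $ i / ?\<sigma>\<bar> < min 1 \<delta>" for i
          using le_less_trans[OF component_le_norm_cart[of d i] d]
          by (simp only: abs_divide abs_of_pos[OF \<theta>] pos_divide_less_eq[OF \<theta>])
        have pos: "0 < (\<theta> + d) $ 2"
          using small[of 2] \<theta> by (auto simp: divide_less_eq abs_less_iff field_simps)
        define r where "r = (\<lambda>x. push ?m (1 + ?t) q x - q x)"
        define L where "L = ?m\<^sup>2 * kernel_form \<alpha> (g 1) (g 1) + 2 * ?m * ?t * kernel_form \<alpha> (g 1) (g 2)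
            + ?t\<^sup>2 * kernel_form \<alpha> (g 2) (g 2)"
        have "?D d = - 1 / 2 * ?\<sigma> powr \<alpha> * kernel_form \<alpha> r r"
          unfolding r_def Q
          by (rule kernel_divergence_eq[OF \<alpha>0 w(1) nonneg prob[unfolded Q] \<theta> pos])
        moreover have \<sigma>2: "?\<sigma> powr \<alpha> = ?\<sigma> powr (\<alpha> - 2) * ?\<sigma>\<^sup>2"
          using \<theta> by (simp add: powr_diff)
        have "d \<bullet> ((?\<sigma> powr (\<alpha> - 2) *\<^sub>R M) *v d) = - 1 / 2 * ?\<sigma> powr \<alpha> * L"
          using kernel_form_sym[OF gw[THEN wL1_measurable] gw[THEN wL1_measurable], of \<alpha> 2 1] \<theta>
          by (simp add: L_def \<sigma>2 inner_vec_def sum_2 matrix_vector_mult_def M field_simps power2_eq_square)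
        ultimately have "?D d - d \<bullet> ((?\<sigma> powr (\<alpha> - 2) *\<^sub>R M) *v d)
            = - (1 / 2 * ?\<sigma> powr \<alpha>) * (kernel_form \<alpha> r r - L)"
          by (simp only:) (simp add: field_simps)
        then have "norm (?D d - d \<bullet> ((?\<sigma> powr (\<alpha> - 2) *\<^sub>R M) *v d))
            = 1 / 2 * ?\<sigma> powr \<alpha> * \<bar>kernel_form \<alpha> r r - L\<bar>"
          by (simp only: real_norm_def abs_mult abs_minus_cancel) simp
        also have "\<dots> \<le> 1 / 2 * ?\<sigma> powr \<alpha> * (\<epsilon> * (\<bar>?m\<bar> + \<bar>?t\<bar>)\<^sup>2)"
          using small[of 1] small[of 2] unfolding L_def by (intro mult_left_mono near) (auto simp: r_def)
        also have "\<dots> = c / 4 * (\<bar>d $ 1\<bar> + \<bar>d $ 2\<bar>)\<^sup>2"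
          using \<theta> by (simp add: \<sigma>2 \<epsilon>_def power_divide flip: add_divide_distrib)
        also have "\<dots> \<le> c / 4 * (2 * norm d)\<^sup>2"
          using component_le_norm_cart[of d 1] component_le_norm_cart[of d 2] c
          by (intro mult_left_mono power_mono) auto
        finally show ?thesis by (simp add: power_mult_distrib)
      qed
      then show "\<forall>\<^sub>F d in at 0. norm (?D d - d \<bullet> ((?\<sigma> powr (\<alpha> - 2) *\<^sub>R M) *v d)) \<le> c * norm ((norm d)\<^sup>2)"
        unfolding eventually_at dist_norm using \<delta> \<theta>
        by (intro exI[of _ "min 1 \<delta> * ?\<sigma>"]) auto
    qed
  qed
  then show ?thesis
    using H unfolding M_def by blast
qed

theorem proposition2:
  fixes \<alpha> :: real and Q0 :: "real measure set"
  assumes "0 < \<alpha>" and "\<alpha> \<le> 2"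
    and "\<And>Q. Q \<in> Q0 \<Longrightarrow> assumption_A \<alpha> Q"
    and "finite_expected_scores (kernel_score \<alpha>) (location_scale_class Q0)"
  shows "\<exists>H :: real measure \<Rightarrow> real \<times> real \<Rightarrow> real ^ 2 ^ 2.
           (\<forall>Q\<in>Q0. integrable (Q \<Otimes>\<^sub>M Q) (H Q)) \<and>
           (\<exists>s. is_scale_function (kernel_score \<alpha>) Q0 s) \<and>
           (\<forall>s. is_scale_function (kernel_score \<alpha>) Q0 s \<longrightarrow>
              (\<forall>Q\<in>Q0. \<forall>\<theta>. 0 < \<theta> $ 2 \<longrightarrow>
                 s Q \<theta> = (\<theta> $ 2) powr (\<alpha> - 2) *\<^sub>R s Q (vector [0, 1]) \<and>
                 s Q \<theta> = (\<theta> $ 2) powr (\<alpha> - 2) *\<^sub>R (\<integral>z. H Q z \<partial>(Q \<Otimes>\<^sub>M Q))))"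
proof -
  let ?matrix = "\<lambda>\<psi> Q \<theta>. (\<theta> $ 2) powr (\<alpha> - 2) *\<^sub>R (\<integral>z. kernel_score_H \<alpha> \<psi> z \<partial>(Q \<Otimes>\<^sub>M Q))"
  have "\<forall>Q\<in>Q0. \<exists>\<psi>. integrable (Q \<Otimes>\<^sub>M Q) (kernel_score_H \<alpha> \<psi>) \<and>
      (\<forall>\<theta>. 0 < \<theta> $ 2 \<longrightarrow> scale_matrix (kernel_score \<alpha>) Q \<theta> (?matrix \<psi> Q \<theta>))"
    by (intro ballI kernel_score_expansion assms)
  then obtain \<psi> where \<psi>: "\<forall>Q\<in>Q0. integrable (Q \<Otimes>\<^sub>M Q) (kernel_score_H \<alpha> (\<psi> Q)) \<and>
      (\<forall>\<theta>. 0 < \<theta> $ 2 \<longrightarrow> scale_matrix (kernel_score \<alpha>) Q \<theta> (?matrix (\<psi> Q) Q \<theta>))"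
    by (rule bchoice[THEN exE])
  have matrix: "s Q \<theta> = ?matrix (\<psi> Q) Q \<theta>"
    if s: "is_scale_function (kernel_score \<alpha>) Q0 s" and Q: "Q \<in> Q0" and \<theta>: "0 < \<theta> $ 2" for s Q \<theta>
  proof (rule scale_matrix_unique)
    show "scale_matrix (kernel_score \<alpha>) Q \<theta> (s Q \<theta>)"
      using s Q \<theta> by (simp add: is_scale_function_iff)
    show "scale_matrix (kernel_score \<alpha>) Q \<theta> (?matrix (\<psi> Q) Q \<theta>)"
      using \<psi> Q \<theta> by blast
  qed
  show ?thesis
  proof (intro exI[of _ "\<lambda>Q. kernel_score_H \<alpha> (\<psi> Q)"] conjI ballI allI impI)
    show "integrable (Q \<Otimes>\<^sub>M Q) (kernel_score_H \<alpha> (\<psi> Q))" if "Q \<in> Q0" for Q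
      using \<psi> that by blast
    show "\<exists>s. is_scale_function (kernel_score \<alpha>) Q0 s"
      using \<psi> by (intro exI[of _ "\<lambda>Q \<theta>. ?matrix (\<psi> Q) Q \<theta>"]) (simp add: is_scale_function_iff)
    fix s Q and \<theta> :: "real ^ 2"
    assume s: "is_scale_function (kernel_score \<alpha>) Q0 s" and Q: "Q \<in> Q0" and \<theta>: "0 < \<theta> $ 2"
    show "s Q \<theta> = ?matrix (\<psi> Q) Q \<theta>"
      by (rule matrix[OF s Q \<theta>])
    moreover have "s Q (vector [0, 1]) = (\<integral>z. kernel_score_H \<alpha> (\<psi> Q) z \<partial>(Q \<Otimes>\<^sub>M Q))"
      using matrix[OF s Q, of "vector [0, 1]"] by simp
    ultimately show "s Q \<theta> = (\<theta> $ 2) powr (\<alpha> - 2) *\<^sub>R s Q (vector [0, 1])"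
      by simp
  qed
qed

end
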